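(* Let $N_\theta, N_y\ge 1$, let $\Sigma_\eta\in\mathbb{R}^{N_y\times N_y}$ be symmetric positive definite, let $y\in\mathbb{R}^{N_y}$, and consider the linear inverse problem in which the forward map is $\mathcal{G}(\theta)=G\theta$ for a matrix $G\in\mathbb{R}^{N_y\times N_\theta}$. Assume that the inverse problem is well-defined, namely that $G$ has full column rank, and that the initial covariance matrix $C_0\in\mathbb{R}^{N_\theta\times N_\theta}$ is (symmetric) strictly positive definite, $C_0\succ 0$. Let $m_0\in\mathbb{R}^{N_\theta}$, and let $(m_n)_{n\ge 0}$ and $(C_n)_{n\ge 0}$ be the means and covariance matrices produced by the unscented Kalman inversion (UKI) iteration described in the context, started from $(m_0,C_0)$ and applied to $\mathcal{G}$, $y$, $\Sigma_\eta$. Then: 1. The iteration for the mean $m_n$ and the covariance matrix $C_n$ converges exponentially fast to limits $m_\infty$ and $C_\infty$. The limiting mean $m_\infty$ is a minimizer of the unregularized least squares functional $$\Phi(\theta)=\tfrac12\big\|\Sigma_\eta^{-1/2}(y-G\theta)\big\|^2 ,$$ and the limiting covariance matrix is $$C_\infty=\big(G^T\Sigma_\eta^{-1}G\big)^{-1},$$ which is the posterior covariance matrix with an uninformative prior, i.e. the covariance matrix of the probability distribution on $\mathbb{R}^{N_\theta}$ with density proportional to $\exp(-\Phi(\theta))$. 2. Let $\theta_{ref}\in\mathbb{R}^{N_\theta}$ be the reference parameter, which satisfies $y-G\theta_{ref}\sim\mathcal{N}(0,\Sigma_\eta)$ (here the observation $y$ is random, and $m_\infty$ is the corresponding limiting mean).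 Then for every index $i\in\{1,\dots,N_\theta\}$, $$P\Big(\big|(\theta_{ref})_{(i)}-(m_\infty)_{(i)}\big|\le 3\sqrt{(C_\infty)_{(i,i)}}\Big)\ge 99.7\%,$$ where the subscripts $(i)$ and $(i,i)$ denote vector and matrix entries.
   Context: Setting: the inverse problem is to recover $\theta\in\mathbb{R}^{N_\theta}$ from an observation $y=\mathcal{G}(\theta)+\eta$, $y\in\mathbb{R}^{N_y}$, with Gaussian noise $\eta\sim\mathcal{N}(0,\Sigma_\eta)$. With prior density $p_0$, the posterior density is proportional to $\exp(-\Phi(\theta))p_0(\theta)$, where $\Phi(\theta)=\frac12\|\Sigma_\eta^{-1/2}(y-\mathcal{G}(\theta))\|^2$ and $\|\cdot\|$ is the Euclidean norm. The uninformative prior is the improper uniform prior $p_0\propto 1$. Exponentially fast convergence of a sequence $x_n$ to $x_\infty$ means that there are constants $K>0$ and $r\in(0,1)$ with $\|x_n-x_\infty\|\le K r^n$ for all $n$. UKI iteration (with hyperparameters $\Sigma_\nu=2\Sigma_\eta$ for the observation error covariance and $\Sigma_\omega=C_n$ for the evolution error covariance at the $n$-th iteration). Constants: $a=\min\{\sqrt{4/(N_\theta+\kappa)},\,1\}$, where $\kappa$ is a fixed real parameter with $N_\theta+\kappa>0$; $c_j=a\sqrt{N_\theta}$ for $1\le j\le N_\theta$; $W_j^c=\frac{1}{2a^2N_\theta}$ for $1\le j\le 2N_\theta$. For a symmetric positive definite matrix $C$, $[\sqrt{C}]_j$ denotes the $j$-th column of the Cholesky factor of $C$ (lower triangular $\sqrt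 C$ with $\sqrt C\sqrt C^T=C$). Given $(m_n,C_n)$, the pair $(m_{n+1},C_{n+1})$ is computed as follows. Prediction step: $\widehat m_{n+1}=m_n$ and $\widehat C_{n+1}=C_n+\Sigma_\omega=2C_n$. Sigma points: $\widehat\theta^0_{n+1}=\widehat m_{n+1}$, and for $1\le j\le N_\theta$, $\widehat\theta^j_{n+1}=\widehat m_{n+1}+c_j[\sqrt{\widehat C_{n+1}}]_j$ and $\widehat\theta^{j+N_\theta}_{n+1}=\widehat m_{n+1}-c_j[\sqrt{\widehat C_{n+1}}]_j$. Analysis step: $\widehat y^j_{n+1}=\mathcal{G}(\widehat\theta^j_{n+1})$ for $0\le j\le 2N_\theta$, $\widehat y_{n+1}=\widehat y^0_{n+1}$, $$\widehat C^{\theta p}_{n+1}=\sum_{j=1}^{2N_\theta}W_j^c(\widehat\theta^j_{n+1}-\widehat m_{n+1})(\widehat y^j_{n+1}-\widehat y_{n+1})^T,$$ $$\widehat C^{pp}_{n+1}=\sum_{j=1}^{2N_\theta}W_j^c(\widehat y^j_{n+1}-\widehat y_{n+1})(\widehat y^j_{n+1}-\widehat y_{n+1})^T+2\Sigma_\eta,$$ $$m_{n+1}=\widehat m_{n+1}+\widehat C^{\theta p}_{n+1}(\widehat C^{pp}_{n+1})^{-1}(y-\widehat y_{n+1}),$$ $$C_{n+1}=\widehat C_{n+1}-\widehat C^{\theta p}_{n+1}(\widehat C^{pp}_{n+1})^{-1}(\widehat C^{\theta p}_{n+1})^T.$$ *)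

theory Defs
  imports "HOL-Probability.Probability"
begin

definition pos_def :: "real^'n^'n \<Rightarrow> bool" where
  "pos_def A \<longleftrightarrow> transpose A = A \<and> (\<forall>x. x \<noteq> 0 \<longrightarrow> 0 < x \<bullet> (A *v x))"

definition outer :: "real^'n \<Rightarrow> real^'m \<Rightarrow> real^'m^'n" where
  "outer u v = (\<chi> i j. u $ i * v $ j)"

definition matrix_sqrt :: "real^'n^'n \<Rightarrow> real^'n^'n" where
  "matrix_sqrt A = (THE R. pos_def R \<and> R ** R = A)"

text \<open>A positive diagonal is the usual normalization that makes the Cholesky factor of a
  positive definite matrix unique. The indices are ordered by the linear order of the index type.\<close>

definition cholesky ::
    "real^('n::{finite,linorder})^('n::_) \<Rightarrow> real^('n::_)^('n::_)" where
  "cholesky A = (THE L. (\<forall>i j. i < j \<longrightarrow> L $ i $ j = 0) \<and> (\<forall>i. 0 < L $ i $ i)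
     \<and> L ** transpose L = A)"

definition misfit ::
    "(real^'n \<Rightarrow> real^'m) \<Rightarrow> real^'m^'m \<Rightarrow> real^'m \<Rightarrow> real^'n \<Rightarrow> real" where
  "misfit \<G> \<Sigma>\<^sub>\<eta> y \<theta> = 1/2 * (norm (matrix_inv (matrix_sqrt \<Sigma>\<^sub>\<eta>) *v (y - \<G> \<theta>)))\<^sup>2"

text \<open>The prior density \<^term>\<open>p\<^sub>0\<close> may be improper.
  If the normalizing integral is infinite, the result is the null measure.\<close>

definition posterior ::
    "(real^'n \<Rightarrow> real) \<Rightarrow> (real^'n \<Rightarrow> real) \<Rightarrow> (real^'n) measure" where
  "posterior p\<^sub>0 \<Phi> = density lborel
     (\<lambda>\<theta>. ennreal (exp (- \<Phi> \<theta>) * p\<^sub>0 \<theta> / (LINT \<theta>'|lborel. exp (- \<Phi> \<theta>') * p\<^sub>0 \<theta>')))"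

definition covariance_matrix :: "(real^'n) measure \<Rightarrow> real^'n^'n" where
  "covariance_matrix \<mu> =
     (LINT x|\<mu>. outer (x - (LINT z|\<mu>. z)) (x - (LINT z|\<mu>. z)))"

definition gaussian_density :: "real^'m \<Rightarrow> real^'m^'m \<Rightarrow> real^'m \<Rightarrow> real" where
  "gaussian_density \<mu> \<Sigma> x =
     exp (- ((x - \<mu>) \<bullet> (matrix_inv \<Sigma> *v (x - \<mu>))) / 2) / sqrt ((2 * pi) ^ CARD('m) * det \<Sigma>)"

definition exp_converges :: "(nat \<Rightarrow> 'a::real_normed_vector) \<Rightarrow> 'a \<Rightarrow> bool" where
  "exp_converges x l \<longleftrightarrow> (\<exists>K r. 0 < K \<and> 0 < r \<and> r < 1 \<and> (\<forall>n. norm (x n - l) \<le> K * r ^ n))"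

definition uki_a :: "nat \<Rightarrow> real \<Rightarrow> real" where
  "uki_a N \<kappa> = min (sqrt (4 / (real N + \<kappa>))) 1"

definition uki_c :: "nat \<Rightarrow> real \<Rightarrow> real" where
  "uki_c N \<kappa> = uki_a N \<kappa> * sqrt (real N)"

definition uki_W :: "nat \<Rightarrow> real \<Rightarrow> real" where
  "uki_W N \<kappa> = 1 / (2 * (uki_a N \<kappa>)\<^sup>2 * real N)"

text \<open>The noncentral sigma points: \<^term>\<open>Inl j\<close> stands for the index $j$
  and \<^term>\<open>Inr j\<close> for the index $j + N_\theta$.\<close>

fun sigma_point ::
    "real \<Rightarrow> real^('n::{finite,linorder}) \<Rightarrow> real^('n::_)^('n::_) \<Rightarrow> 'n + 'n
     \<Rightarrow> real^('n::_)" where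
  "sigma_point \<kappa> m C (Inl j) = m + uki_c CARD('n) \<kappa> *\<^sub>R column j (cholesky C)"
| "sigma_point \<kappa> m C (Inr j) = m - uki_c CARD('n) \<kappa> *\<^sub>R column j (cholesky C)"

definition uki_step ::
    "real \<Rightarrow> (real^('n::{finite,linorder}) \<Rightarrow> real^'m) \<Rightarrow> real^'m^'m \<Rightarrow> real^'m
     \<Rightarrow> (real^('n::_)) \<times> (real^('n::_)^('n::_))
     \<Rightarrow> (real^('n::_)) \<times> (real^('n::_)^('n::_))" where
  "uki_step \<kappa> \<G> \<Sigma>\<^sub>\<eta> y = (\<lambda>(m, C).
     let \<Sigma>\<^sub>\<omega> = C;
         \<Sigma>\<^sub>\<nu> = 2 *\<^sub>R \<Sigma>\<^sub>\<eta>;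
         m' = m;
         C' = C + \<Sigma>\<^sub>\<omega>;
         \<theta>' = sigma_point \<kappa> m' C';
         y' = \<G> m';
         W = uki_W CARD('n) \<kappa>;
         C\<^sub>\<theta>\<^sub>p = (\<Sum>j\<in>UNIV. W *\<^sub>R outer (\<theta>' j - m') (\<G> (\<theta>' j) - y'));
         C\<^sub>p\<^sub>p = (\<Sum>j\<in>UNIV. W *\<^sub>R outer (\<G> (\<theta>' j) - y') (\<G> (\<theta>' j) - y')) + \<Sigma>\<^sub>\<nu>
     in (m' + (C\<^sub>\<theta>\<^sub>p ** matrix_inv C\<^sub>p\<^sub>p) *v (y - y'),
         C' - C\<^sub>\<theta>\<^sub>p ** matrix_inv C\<^sub>p\<^sub>p ** transpose C\<^sub>\<theta>\<^sub>p))"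

definition uki ::
    "real \<Rightarrow> (real^('n::{finite,linorder}) \<Rightarrow> real^'m) \<Rightarrow> real^'m^'m \<Rightarrow> real^'m
     \<Rightarrow> real^('n::_) \<Rightarrow> real^('n::_)^('n::_) \<Rightarrow> nat
     \<Rightarrow> (real^('n::_)) \<times> (real^('n::_)^('n::_))" where
  "uki \<kappa> \<G> \<Sigma>\<^sub>\<eta> y m\<^sub>0 C\<^sub>0 n = (uki_step \<kappa> \<G> \<Sigma>\<^sub>\<eta> y ^^ n) (m\<^sub>0, C\<^sub>0)"

end

theory Submission
  imports Defs
begin

text \<open>For a linear forward map the sigma point sums are exact, so with \<open>B = G\<^sup>T \<Sigma>\<^sup>-\<^sup>1 G\<close> and \<open>B m\<^sub>\<infinity> = G\<^sup>T \<Sigma>\<^sup>-\<^sup>1 y\<close>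
  one step of the iteration is a Kalman update, which in information form reads
  \<open>C\<^sub>n\<^sub>+\<^sub>1\<^sup>-\<^sup>1 = (C\<^sub>n\<^sup>-\<^sup>1 + B) / 2\<close> and
  \<open>C\<^sub>n\<^sub>+\<^sub>1\<^sup>-\<^sup>1 (m\<^sub>n\<^sub>+\<^sub>1 - m\<^sub>\<infinity>) = C\<^sub>n\<^sup>-\<^sup>1 (m\<^sub>n - m\<^sub>\<infinity>) / 2\<close>. Hence \<open>C\<^sub>n\<^sup>-\<^sup>1 - B\<close> and
  \<open>C\<^sub>n\<^sup>-\<^sup>1 (m\<^sub>n - m\<^sub>\<infinity>)\<close> are halved in every step, while the \<open>C\<^sub>n\<^sup>-\<^sup>1\<close> are uniformly coercive.
  The error \<open>\<theta>\<^sub>r\<^sub>e\<^sub>f - m\<^sub>\<infinity>\<close> is a linear image of the noise, so its components are centered normal with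
  variances \<open>(B\<^sup>-\<^sup>1)\<^sub>i\<^sub>i\<close>. The marginal laws of a Gaussian density are obtained without a linear change of
  variables, from the uniqueness of translation invariant measures on the line.\<close>

section \<open>Positive definite matrices\<close>

lemma matrix_inv_right:
  fixes A :: "'a::semiring_1^'n^'m"
  assumes "invertible A" shows "A ** matrix_inv A = mat 1"
  using assms unfolding invertible_def matrix_inv_def by (rule someI2_ex) blast

lemma matrix_inv_left:
  fixes A :: "'a::semiring_1^'n^'m"
  assumes "invertible A" shows "matrix_inv A ** A = mat 1"
  using assms unfolding invertible_def matrix_inv_def by (rule someI2_ex) blast

lemma matrix_inv_unique:
  fixes A B :: "'a::field^'n^'n"
  assumes "A ** B = mat 1"
  shows "matrix_inv A = B"
proof -
  have "B ** A = mat 1"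
    using assms by (simp add: matrix_left_right_inverse)
  then have "invertible A"
    using assms unfolding invertible_def by blast
  then have "matrix_inv A ** (A ** B) = B"
    by (simp add: matrix_mul_assoc matrix_inv_left)
  then show ?thesis
    by (simp add: assms)
qed

lemma inner_matrix_vector_mult:
  fixes A :: "real^'n^'m"
  shows "x \<bullet> (A *v y) = (transpose A *v x) \<bullet> y"
  by (simp add: dot_lmul_matrix)

lemma symmetricI:
  fixes A :: "real^'n^'n"
  assumes "\<And>x y. x \<bullet> (A *v y) = (A *v x) \<bullet> y"
  shows "transpose A = A"
proof -
  have "transpose A *v x = A *v x" for x
    using assms[of x] by (metis inner_matrix_vector_mult vector_eq_rdot)
  then show ?thesis
    by (simp add: matrix_eq)
qed

lemma pos_def_symmetric:
  "pos_def A \<Longrightarrow> x \<bullet> (A *v y) = (A *v x) \<bullet> y"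
  unfolding pos_def_def by (metis inner_matrix_vector_mult)

lemma pos_def_pos: "pos_def A \<Longrightarrow> x \<noteq> 0 \<Longrightarrow> 0 < x \<bullet> (A *v x)"
  by (simp add: pos_def_def)

lemma pos_def_nonneg: "pos_def A \<Longrightarrow> 0 \<le> x \<bullet> (A *v x)"
  by (cases "x = 0") (auto simp: pos_def_def less_imp_le)

lemma pos_defI:
  fixes A :: "real^'n^'n"
  assumes "\<And>x y. x \<bullet> (A *v y) = (A *v x) \<bullet> y" "\<And>x. x \<noteq> 0 \<Longrightarrow> 0 < x \<bullet> (A *v x)"
  shows "pos_def A"
  using assms symmetricI[of A] by (simp add: pos_def_def)

lemma pos_def_invertible:
  assumes "pos_def A" shows "invertible A"
proof -
  have "x = 0" if "A *v x = 0" for x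
    using pos_def_pos[OF assms, of x] that by (cases "x = 0") auto
  then show ?thesis
    by (metis invertible_left_inverse matrix_left_invertible_ker)
qed

lemma pos_def_matrix_inv_cancel [simp]:
  assumes "pos_def A"
  shows "A *v (matrix_inv A *v x) = x" "matrix_inv A *v (A *v x) = x"
  using matrix_inv_right[OF pos_def_invertible[OF assms]] matrix_inv_left[OF pos_def_invertible[OF assms]]
  by (simp_all add: matrix_vector_mul_assoc)

lemma pos_def_matrix_inv:
  assumes "pos_def A" shows "pos_def (matrix_inv A)"
proof (rule pos_defI)
  fix x y
  show "x \<bullet> (matrix_inv A *v y) = (matrix_inv A *v x) \<bullet> y"
    using pos_def_symmetric[OF assms, of "matrix_inv A *v x" "matrix_inv A *v y"] assms by simp
next
  fix x :: "real^'a" assume "x \<noteq> 0"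
  then have "matrix_inv A *v x \<noteq> 0"
    using assms by (metis matrix_vector_mult_0_right pos_def_matrix_inv_cancel(1))
  from pos_def_pos[OF assms this] show "0 < x \<bullet> (matrix_inv A *v x)"
    using assms by (simp add: inner_commute)
qed

lemma pos_def_add: "pos_def A \<Longrightarrow> pos_def B \<Longrightarrow> pos_def (A + B)"
  by (rule pos_defI)
    (auto simp: matrix_vector_mult_add_rdistrib inner_add_left inner_add_right
      pos_def_symmetric[symmetric] pos_def_pos add_pos_pos)

lemma pos_def_scaleR: "pos_def A \<Longrightarrow> 0 < c \<Longrightarrow> pos_def (c *\<^sub>R A)"
  by (rule pos_defI)
    (auto simp flip: scaleR_matrix_vector_assoc simp: pos_def_symmetric[symmetric] pos_def_pos)

text \<open>The constant is the minimum of the quadratic form on the unit sphere, attained by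
  compactness; homogeneity extends the bound to all vectors.\<close>

lemma pos_def_coercive:
  fixes A :: "real^'n^'n"
  assumes "pos_def A"
  obtains l where "0 < l" "\<And>x. l * (norm x)\<^sup>2 \<le> x \<bullet> (A *v x)"
proof -
  obtain e :: "real^'n" where e: "norm e = 1"
    using vector_choose_size[of 1] by auto
  have "continuous_on (sphere 0 1) (\<lambda>x. x \<bullet> (A *v x))"
    by (intro continuous_intros matrix_vector_mult_linear_continuous_on)
  then obtain z where z: "norm z = 1" "\<And>x. norm x = 1 \<Longrightarrow> z \<bullet> (A *v z) \<le> x \<bullet> (A *v x)"
    using continuous_attains_inf[of "sphere 0 1" "\<lambda>x. x \<bullet> (A *v x)"] e by (auto simp: dist_norm)
  have "z \<bullet> (A *v z) * (norm x)\<^sup>2 \<le> x \<bullet> (A *v x)" for x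
  proof (cases "x = 0")
    case False
    then have "z \<bullet> (A *v z) \<le> (x /\<^sub>R norm x) \<bullet> (A *v (x /\<^sub>R norm x))"
      by (intro z) auto
    also have "\<dots> = (x \<bullet> (A *v x)) / (norm x)\<^sup>2"
      by (simp add: matrix_vector_mult_scaleR power2_eq_square divide_simps)
    finally show ?thesis
      using False by (simp add: field_simps)
  qed auto
  moreover have "0 < z \<bullet> (A *v z)"
    using z(1) by (intro pos_def_pos assms) auto
  ultimately show ?thesis
    using that by blast
qed

section \<open>Spectral theorem and square roots of positive definite matrices\<close>

text \<open>Induction on the dimension of an invariant subspace: a maximizer of the Rayleigh
  quotient on its unit sphere is an eigenvector, and the orthogonal complement of this vector inside
  the subspace is again invariant. The claim ranges over subspaces so that the induction can pass to
  this complement.\<close>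

lemma selfadjoint_eigenbasis:
  fixes f :: "'a::euclidean_space \<Rightarrow> 'a"
  assumes f: "linear f" "\<And>x y. f x \<bullet> y = x \<bullet> f y"
  shows "subspace S \<Longrightarrow> f ` S \<subseteq> S \<Longrightarrow>
    \<exists>B. finite B \<and> pairwise orthogonal B \<and> span B = S \<and> (\<forall>b\<in>B. norm b = 1 \<and> f b = (b \<bullet> f b) *\<^sub>R b)"
proof (induction "dim S" arbitrary: S rule: less_induct)
  case less
  show ?case
  proof (cases "S \<subseteq> {0}")
    case True
    then have "S = {0}"
      using less.prems(1) subspace_0 by blast
    then show ?thesis
      by (intro exI[of _ "{}"]) auto
  next
    case False
    then obtain s where s: "s \<in> S" "s \<noteq> 0" by auto
    have "compact (S \<inter> sphere 0 1)"
      using closed_subspace[OF less.prems(1)] by (simp add: closed_Int_compact)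
    moreover have "s /\<^sub>R norm s \<in> S \<inter> sphere 0 1"
      using s less.prems(1) by (simp add: subspace_scale)
    then have "S \<inter> sphere 0 1 \<noteq> {}"
      by blast
    moreover have "continuous_on (S \<inter> sphere 0 1) (\<lambda>x. x \<bullet> f x)"
      by (intro continuous_intros linear_continuous_on linear_conv_bounded_linear[THEN iffD1] f)
    ultimately obtain v where "v \<in> S \<inter> sphere 0 1" "\<forall>x\<in>S \<inter> sphere 0 1. x \<bullet> f x \<le> v \<bullet> f v"
      using continuous_attains_sup[of "S \<inter> sphere 0 1" "\<lambda>x. x \<bullet> f x"] by blast
    then have v: "v \<in> S" "norm v = 1"
      and vmax: "\<And>x. x \<in> S \<Longrightarrow> norm x = 1 \<Longrightarrow> x \<bullet> f x \<le> v \<bullet> f v"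
      by auto
    define l where "l = v \<bullet> f v"
    \<comment> \<open>A quadratic form that is nonnegative on \<open>S\<close> and vanishes at
      \<open>v\<close>, so its derivative at \<open>v\<close> in the direction \<open>w\<close> must
      vanish; that derivative is \<open>2 * (w \<bullet> w)\<close>.\<close>
    define g where "g = (\<lambda>x. l * (x \<bullet> x) - x \<bullet> f x)"
    have g_nonneg: "0 \<le> g x" if "x \<in> S" for x
    proof (cases "x = 0")
      case False
      have "(x /\<^sub>R norm x) \<bullet> f (x /\<^sub>R norm x) \<le> l"
        unfolding l_def using that False less.prems(1) by (intro vmax) (auto simp: subspace_scale)
      then show ?thesis
        using False
        by (simp add: g_def linear_scale[OF f(1)] dot_square_norm power2_eq_square field_simps)
    qed (simp add: g_def)
    define w where "w = l *\<^sub>R v - f v"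
    have wS: "w \<in> S"
      using v less.prems by (auto simp: w_def intro: subspace_diff subspace_scale)
    have vv: "v \<bullet> v = 1"
      using v by (simp add: dot_square_norm)
    have "0 \<le> 2 * t * (w \<bullet> w) + t\<^sup>2 * g w" for t
    proof -
      have "0 \<le> g (v + t *\<^sub>R w)"
        using v wS less.prems(1) by (intro g_nonneg) (auto intro: subspace_add subspace_scale)
      also have "g (v + t *\<^sub>R w) = 2 * t * (l * (v \<bullet> w) - w \<bullet> f v) + t\<^sup>2 * g w"
        using f(2)[of w v]
        by (simp add: g_def linear_add[OF f(1)] linear_scale[OF f(1)] inner_add_left inner_add_right
            vv l_def[symmetric] inner_commute f(2) power2_eq_square algebra_simps)
      also have "l * (v \<bullet> w) - w \<bullet> f v = w \<bullet> w"
        by (simp add: w_def inner_diff_left inner_diff_right inner_commute algebra_simps)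
      finally show ?thesis .
    qed
    note quad = this
    have "w \<bullet> w = 0"
    proof (rule ccontr)
      assume "w \<bullet> w \<noteq> 0"
      then have ww: "0 < w \<bullet> w" by (simp add: inner_gt_zero_iff)
      \<comment> \<open>The minimizer of \<open>2 * t * p + t\<^sup>2 * d\<close> is
        \<open>- p / d\<close>; taking \<open>d = g w + w \<bullet> w\<close> instead of
        \<open>g w\<close> keeps the denominator positive even if \<open>g w = 0\<close>.\<close>
      define t where "t = - (w \<bullet> w) / (g w + w \<bullet> w)"
      have eq: "2 * (- p / d) * p + (- p / d)\<^sup>2 * d = - p\<^sup>2 / d" if "d \<noteq> 0" for p d :: real
        using that by (simp add: power2_eq_square field_simps)
      have d: "0 < g w + w \<bullet> w" using ww g_nonneg[OF wS] by (rule add_nonneg_pos[rotated])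
      have "2 * t * (w \<bullet> w) + t\<^sup>2 * g w \<le> 2 * t * (w \<bullet> w) + t\<^sup>2 * (g w + w \<bullet> w)"
        using ww by (simp add: mult_left_mono)
      also have "\<dots> = - (w \<bullet> w)\<^sup>2 / (g w + w \<bullet> w)"
        using d unfolding t_def by (intro eq) simp
      also have "\<dots> < 0" using ww d by (simp add: divide_neg_pos)
      finally show False using quad[of t] by simp
    qed
    then have fv: "f v = l *\<^sub>R v"
      by (simp add: w_def)
    define T where "T = {x \<in> S. x \<bullet> v = 0}"
    have T: "subspace T"
      using less.prems(1) by (auto simp: T_def subspace_def inner_add_left)
    have fT: "f ` T \<subseteq> T"
      using less.prems(2) by (auto simp: T_def f(2) fv)
    have "v \<notin> T"
      using vv by (simp add: T_def)
    then have "T \<subset> S"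
      using v(1) unfolding T_def by blast
    then have "dim T < dim S"
      using T less.prems(1) by (intro dim_psubset) (simp add: span_eq_iff[THEN iffD2])
    from less.hyps[OF this T fT] obtain B where B: "finite B" "pairwise orthogonal B" "span B = T"
      "\<And>b. b \<in> B \<Longrightarrow> norm b = 1" "\<And>b. b \<in> B \<Longrightarrow> f b = (b \<bullet> f b) *\<^sub>R b"
      by blast
    have BT: "B \<subseteq> T"
      using B(3) span_superset by blast
    have "span (insert v B) = S"
    proof
      show "span (insert v B) \<subseteq> S"
        using v BT less.prems(1) by (intro span_minimal) (auto simp: T_def)
      show "S \<subseteq> span (insert v B)"
      proof
        fix x assume "x \<in> S"
        then have "x - (x \<bullet> v) *\<^sub>R v \<in> span B"
          using v less.prems(1) by (auto simp: B(3) T_def inner_diff_left vv subspace_diff subspace_scale)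
        then show "x \<in> span (insert v B)"
          unfolding span_insert by blast
      qed
    qed
    moreover have "pairwise orthogonal (insert v B)"
      using B(2) BT by (auto simp: pairwise_insert orthogonal_def T_def inner_commute)
    ultimately show ?thesis
      using B v fv by (intro exI[of _ "insert v B"]) (auto simp: l_def)
  qed
qed

lemma pos_def_square_root_exists:
  fixes A :: "real^'n^'n"
  assumes A: "pos_def A"
  shows "\<exists>R. pos_def R \<and> R ** R = A"
proof -
  obtain B where B: "finite B" "pairwise orthogonal B" "span B = UNIV"
      "\<And>b. b \<in> B \<Longrightarrow> norm b = 1" "\<And>b. b \<in> B \<Longrightarrow> A *v b = (b \<bullet> (A *v b)) *\<^sub>R b"
    using selfadjoint_eigenbasis[of "\<lambda>x. A *v x" UNIV] pos_def_symmetric[OF A] by auto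
  \<comment> \<open>For a unit eigenvector the Rayleigh quotient is the eigenvalue, so
    \<open>l b\<close> is its square root; \<open>h\<close> below scales each eigenvector by
    it.\<close>
  define l where "l b = sqrt (b \<bullet> (A *v b))" for b
  have b_nz: "b \<noteq> 0" if "b \<in> B" for b using B(4)[OF that] by auto
  have l_pos: "0 < l b" if "b \<in> B" for b
    using pos_def_pos[OF A b_nz[OF that]] by (simp add: l_def)
  have l_sq: "l b * l b = b \<bullet> (A *v b)" for b
    using pos_def_nonneg[OF A] by (simp add: l_def)
  have expand: "(\<Sum>b\<in>B. (x \<bullet> b) *\<^sub>R b) = x" for x
    using B by (intro orthonormal_basis_expand) auto
  define h where "h x = (\<Sum>b\<in>B. (l b * (x \<bullet> b)) *\<^sub>R b)" for x
  have lin: "linear h"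
    unfolding h_def
    by (rule linearI) (auto simp: inner_add_left algebra_simps sum.distrib scaleR_sum_right)
  have R: "matrix h *v x = h x" for x
    using lin by (simp add: matrix_works linear_linear linear_matrix_vector_mul_eq)
  have h_inner: "h x \<bullet> c = l c * (x \<bullet> c)" if "c \<in> B" for x c
  proof -
    have "h x \<bullet> c = (\<Sum>b\<in>B. (l b * (x \<bullet> b)) * (b \<bullet> c))"
      by (simp add: h_def inner_sum_left)
    also have "\<dots> = (\<Sum>b\<in>B. if b = c then l b * (x \<bullet> b) else 0)"
      using B(2,4) that
      by (intro sum.cong refl) (auto simp: pairwise_def orthogonal_def dot_square_norm)
    finally show ?thesis
      using B(1) that by simp
  qed
  have "h (h x) = A *v x" for x
  proof -
    have "h (h x) = (\<Sum>b\<in>B. (x \<bullet> b) *\<^sub>R (A *v b))"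
      unfolding h_def[of "h x"] using B(5)
      by (intro sum.cong refl) (simp add: h_inner mult.assoc[symmetric] l_sq, metis mult.commute scaleR_scaleR)
    also have "\<dots> = A *v (\<Sum>b\<in>B. (x \<bullet> b) *\<^sub>R b)"
      by (simp add: matrix_vector_mult_scaleR linear_sum[OF matrix_vector_mul_linear])
    finally show ?thesis by (simp add: expand)
  qed
  then have "matrix h ** matrix h = A"
    by (simp add: matrix_eq matrix_vector_mul_assoc[symmetric] R)
  moreover have "pos_def (matrix h)"
  proof (rule pos_defI)
    show "x \<bullet> (matrix h *v y) = (matrix h *v x) \<bullet> y" for x y
      by (simp add: R h_def inner_sum_left inner_sum_right inner_commute mult_ac)
  next
    fix x :: "real^'n" assume "x \<noteq> 0"
    then obtain c where c: "c \<in> B" "x \<bullet> c \<noteq> 0"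
      using expand[of x] by (metis (no_types, lifting) scaleR_eq_0_iff sum.neutral)
    have "x \<bullet> h x = (\<Sum>b\<in>B. l b * (x \<bullet> b)\<^sup>2)"
      by (simp add: h_def inner_sum_right power2_eq_square mult_ac)
    also have "\<dots> > 0"
      using B(1) c l_pos by (intro sum_pos2[of _ c]) (auto simp: less_imp_le)
    finally show "0 < x \<bullet> (matrix h *v x)"
      by (simp add: R)
  qed
  ultimately show ?thesis by blast
qed

text \<open>With \<open>D = R - S\<close>, the identity \<open>R D + D S = 0\<close> gives \<open>tr (D R D) + tr (D S D) = 0\<close>, and both
  summands are nonnegative.\<close>

lemma pos_def_square_root_unique:
  fixes R S :: "real^'n^'n"
  assumes R: "pos_def R" and S: "pos_def S" and eq: "R ** R = S ** S"
  shows "R = S"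
proof -
  define D where "D = R - S"
  have Dsym: "transpose D = D"
    using R S by (simp add: D_def pos_def_def transpose_def vec_eq_iff)
  have RD: "R ** D + D ** S = 0"
    unfolding matrix_eq D_def
    using eq by (simp add: algebra_simps matrix_vector_mul_assoc[symmetric])
     (metis matrix_vector_mul_assoc)
  \<comment> \<open>Since \<open>D\<close> is symmetric, this trace is the quadratic form of
    \<open>M\<close> summed over the columns of \<open>D\<close>, hence nonnegative for positive
    definite \<open>M\<close>.\<close>
  have tr: "trace (D ** (M ** D)) = (\<Sum>j\<in>UNIV. column j D \<bullet> (M *v column j D))" for M
  proof -
    have "D ** (M ** D) = transpose D ** (M ** D)" by (simp add: Dsym)
    then show ?thesis
      by (simp add: trace_def matrix_matrix_mult_def column_def transpose_def inner_vec_def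
          matrix_vector_mult_def)
  qed
  \<comment> \<open>Cyclicity of the trace turns \<open>D ** (S ** D)\<close> into
    \<open>D ** (D ** S)\<close>, so that the identity \<open>RD\<close> applies.\<close>
  have "trace (D ** (R ** D)) + trace (D ** (S ** D)) = trace (D ** (R ** D + D ** S))"
    by (simp add: matrix_add_ldistrib trace_add) (metis matrix_mul_assoc trace_mul_sym)
  also have "\<dots> = 0"
    unfolding RD by (simp add: trace_def matrix_matrix_mult_def)
  finally have "(\<Sum>j\<in>UNIV. column j D \<bullet> (R *v column j D)) + (\<Sum>j\<in>UNIV. column j D \<bullet> (S *v column j D)) = 0"
    by (simp add: tr)
  moreover have "0 \<le> (\<Sum>j\<in>UNIV. column j D \<bullet> (S *v column j D))"
    "0 \<le> (\<Sum>j\<in>UNIV. column j D \<bullet> (R *v column j D))"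
    using R S by (auto intro!: sum_nonneg pos_def_nonneg)
  ultimately have "(\<Sum>j\<in>UNIV. column j D \<bullet> (R *v column j D)) = 0"
    by linarith
  then have "column j D \<bullet> (R *v column j D) = 0" for j
    using R by (subst (asm) sum_nonneg_eq_0_iff) (auto intro: pos_def_nonneg)
  then have "column j D = 0" for j
    using pos_def_pos[OF R, of "column j D"] by (metis less_irrefl)
  then have "D = 0"
    by (simp add: column_def vec_eq_iff)
  then show ?thesis by (simp add: D_def)
qed

lemma matrix_sqrt:
  fixes A :: "real^'n^'n"
  assumes "pos_def A"
  shows "pos_def (matrix_sqrt A)" "matrix_sqrt A ** matrix_sqrt A = A"
proof -
  have "\<exists>!R. pos_def R \<and> R ** R = A"
    using pos_def_square_root_exists[OF assms] pos_def_square_root_unique by blast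
  from theI'[OF this] show "pos_def (matrix_sqrt A)" "matrix_sqrt A ** matrix_sqrt A = A"
    by (simp_all add: matrix_sqrt_def)
qed

text \<open>The inverse of \<open>A\<close> is the square of the inverse root, and the latter is
  symmetric. The misfit thereby becomes a quadratic form in \<open>matrix_inv A\<close>, free of
  roots.\<close>

lemma norm_matrix_inv_sqrt:
  fixes A :: "real^'n^'n"
  assumes A: "pos_def A"
  shows "(norm (matrix_inv (matrix_sqrt A) *v v))\<^sup>2 = v \<bullet> (matrix_inv A *v v)"
proof -
  define R where "R = matrix_sqrt A"
  have R: "pos_def R" "R ** R = A" using matrix_sqrt[OF A] by (auto simp: R_def)
  have "A *v (matrix_inv R *v (matrix_inv R *v v)) = v"
    using R(1) by (simp add: R(2)[symmetric] matrix_vector_mul_assoc[symmetric])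
  then have "matrix_inv A *v v = matrix_inv R *v (matrix_inv R *v v)"
    using A by (metis pos_def_matrix_inv_cancel(2))
  then show ?thesis
    using pos_def_symmetric[OF pos_def_matrix_inv[OF R(1)], of v "matrix_inv R *v v"]
    by (simp add: R_def[symmetric] dot_square_norm)
qed

section \<open>Cholesky factorization\<close>

text \<open>Gram-Schmidt: \<open>q i\<close> is the normalized component of \<open>row i R\<close> orthogonal to the preceding rows.\<close>

lemma gram_schmidt_rows:
  fixes R :: "real^('n::{finite,linorder})^('n::_)"
  assumes R: "invertible R"
  obtains q :: "'n::{finite,linorder} \<Rightarrow> real^('n::_)"
  where "\<And>i j. q i \<bullet> q j = (if i = j then 1 else 0)"
    "\<And>i j. i < j \<Longrightarrow> row i R \<bullet> q j = 0" "\<And>i. 0 < row i R \<bullet> q i"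
proof -
  let ?r = "\<lambda>i. row i R"
  have ind: "?r i \<notin> span (?r ` {j. j < i})" for i
  proof
    assume a: "?r i \<in> span (?r ` {j. j < i})"
    \<comment> \<open>\<open>rows R\<close> is a set, so the rows must be distinct for the earlier
      ones to survive the removal of \<open>?r i\<close>.\<close>
    have inj: "?r j = ?r k \<Longrightarrow> j = k" for j k
    proof -
      assume "?r j = ?r k"
      then have "axis j 1 v* R = axis k 1 v* R"
        by (simp add: vector_matrix_mult_def row_def vec_eq_iff axis_def if_distrib if_distribR cong: if_cong)
      then have "(axis j 1 v* R) v* matrix_inv R = (axis k 1 v* R) v* matrix_inv R" by simp
      then show "j = k"
        by (simp add: vector_matrix_mul_assoc matrix_inv_right[OF R] axis_eq_axis)
    qed
    have "?r ` {j. j < i} \<subseteq> rows R - {?r i}"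
      using inj by (auto simp: rows_def)
    then have "?r i \<in> span (rows R - {?r i})"
      using a span_mono[of "?r ` {j. j < i}" "rows R - {?r i}"] by (simp add: subset_iff)
    moreover have "?r i \<in> rows R"
      by (auto simp: rows_def)
    ultimately have "dependent (rows R)"
      unfolding dependent_def by blast
    then show False
      using R by (simp add: det_dependent_rows dependent_vec_eq[symmetric] invertible_det_nz)
  qed
  have "\<exists>v. norm v = 1 \<and> v \<in> span (?r ` {j. j \<le> i}) \<and> (\<forall>j<i. ?r j \<bullet> v = 0) \<and> 0 < ?r i \<bullet> v" for i
  proof -
    obtain y z where yz: "y \<in> span (?r ` {j. j < i})"
        "\<And>w. w \<in> span (?r ` {j. j < i}) \<Longrightarrow> orthogonal z w" "?r i = y + z"
      using orthogonal_subspace_decomp_exists by blast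
    have "z \<noteq> 0"
      using yz(1,3) ind by auto
    have "z = ?r i - y"
      using yz(3) by simp
    moreover have "y \<in> span (?r ` {j. j \<le> i})"
      by (rule subsetD[OF span_mono yz(1)]) auto
    ultimately have "z \<in> span (?r ` {j. j \<le> i})"
      by (auto intro: span_diff span_base)
    moreover have "?r j \<bullet> z = 0" if "j < i" for j
      using yz(2)[of "?r j"] that by (simp add: span_base orthogonal_def inner_commute)
    moreover have "?r i \<bullet> z = z \<bullet> z"
      using yz(2)[OF yz(1)] by (simp add: yz(3) inner_add_left inner_add_right orthogonal_def inner_commute)
    ultimately show ?thesis
      using \<open>z \<noteq> 0\<close> by (intro exI[of _ "z /\<^sub>R norm z"]) (auto simp: span_scale)
  qed
  then obtain q where q: "\<And>i. norm (q i) = 1" "\<And>i. q i \<in> span (?r ` {j. j \<le> i})"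
      "\<And>i j. j < i \<Longrightarrow> ?r j \<bullet> q i = 0" "\<And>i. 0 < ?r i \<bullet> q i"
    by metis
  \<comment> \<open>\<open>q i\<close> lies in the span of the rows up to \<open>i\<close>; all of
    these precede \<open>j\<close> and are therefore orthogonal to \<open>q j\<close>.\<close>
  have orth: "q i \<bullet> q j = 0" if "i < j" for i j
  proof -
    have "orthogonal (q j) x" if "x \<in> span (?r ` {k. k \<le> i})" for x
      using that
    proof (rule orthogonal_to_span)
      show "orthogonal (q j) y" if "y \<in> ?r ` {k. k \<le> i}" for y
        using that q(3) \<open>i < j\<close> by (auto simp: orthogonal_def inner_commute)
    qed
    from this[OF q(2)] show ?thesis
      by (simp add: orthogonal_def inner_commute)
  qed
  have "q i \<bullet> q j = (if i = j then 1 else 0)" for i j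
    using orth[of i j] orth[of j i] q(1)[of i]
    by (cases i j rule: linorder_cases) (auto simp: dot_square_norm inner_commute)
  with q that show thesis by blast
qed

text \<open>Write the symmetric root as \<open>R = L ** Q\<close> with the Gram-Schmidt vectors as
  rows of \<open>Q\<close>. Then \<open>L ** transpose L = R ** transpose R = A\<close>, and the
  entries \<open>row i R \<bullet> q j\<close> of \<open>L\<close> vanish above the diagonal and are
  positive on it.\<close>

lemma cholesky_exists:
  fixes A :: "real^('n::{finite,linorder})^('n::_)"
  assumes A: "pos_def A"
  shows "\<exists>L. (\<forall>i j. i < j \<longrightarrow> L $ i $ j = 0) \<and> (\<forall>i. 0 < L $ i $ i) \<and> L ** transpose L = A"
proof -
  obtain R where R: "pos_def R" "R ** R = A"
    using pos_def_square_root_exists[OF A] by blast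
  obtain q :: "'n::{finite,linorder} \<Rightarrow> real^('n::_)"
    where q: "\<And>i j. q i \<bullet> q j = (if i = j then 1 else 0)"
    "\<And>i j. i < j \<Longrightarrow> row i R \<bullet> q j = 0" "\<And>i. 0 < row i R \<bullet> q i"
    using gram_schmidt_rows[OF pos_def_invertible[OF R(1)]] by blast
  define Q where "Q = (\<chi> i. q i)"
  have "Q ** transpose Q = mat 1"
    by (simp add: Q_def matrix_matrix_mult_def transpose_def mat_def vec_eq_iff q(1)[unfolded inner_vec_def, simplified])
  then have Q: "transpose Q ** Q = mat 1"
    by (simp add: matrix_left_right_inverse)
  define L where "L = R ** transpose Q"
  have L: "L $ i $ j = row i R \<bullet> q j" for i j
    by (simp add: L_def matrix_matrix_mult_def transpose_def Q_def row_def inner_vec_def)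
  have "L ** transpose L = R ** (transpose Q ** Q) ** transpose R"
    by (simp add: L_def matrix_transpose_mul matrix_mul_assoc)
  also have "\<dots> = A"
    using R by (simp add: Q pos_def_def)
  finally show ?thesis
    using q by (intro exI[of _ L]) (simp add: L)
qed

text \<open>By triangularity, entry \<open>(i, j)\<close> of the product involves only columns
  before \<open>j\<close> and the term \<open>L $ i $ j * L $ j $ j\<close>. Once the earlier
  columns agree, \<open>i = j\<close> and positivity fix the diagonal entry, and division by it
  fixes the rest of column \<open>j\<close>.\<close>

lemma cholesky_unique:
  fixes L M :: "real^('n::{finite,linorder})^('n::_)"
  assumes L: "\<And>i j. i < j \<Longrightarrow> L $ i $ j = 0" "\<And>i. 0 < L $ i $ i"
    and M: "\<And>i j. i < j \<Longrightarrow> M $ i $ j = 0" "\<And>i. 0 < M $ i $ i"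
    and eq: "L ** transpose L = M ** transpose M"
  shows "L = M"
proof -
  have expand: "(T ** transpose T) $ i $ j = (\<Sum>k\<in>{k. k < j}. T $ i $ k * T $ j $ k) + T $ i $ j * T $ j $ j"
    if "\<And>i j. i < j \<Longrightarrow> T $ i $ j = 0" for T :: "real^('n::{finite,linorder})^('n::_)" and i j
  proof -
    have "(T ** transpose T) $ i $ j = (\<Sum>k\<in>UNIV. T $ i $ k * T $ j $ k)"
      by (simp add: matrix_matrix_mult_def transpose_def)
    also have "\<dots> = (\<Sum>k\<in>insert j {k. k < j}. T $ i $ k * T $ j $ k)"
      using that by (intro sum.mono_neutral_right) (auto simp: not_less)
    finally show ?thesis
      by simp
  qed
  have "\<forall>i. L $ i $ j = M $ i $ j" for j
  \<comment> \<open>Counting the predecessors of \<open>j\<close> turns the order of the finite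
    index type into an induction from the first column to the last.\<close>
  proof (induction "card {k. k < j}" arbitrary: j rule: less_induct)
    case less
    have IH: "L $ i $ k = M $ i $ k" if "k < j" for i k
    proof -
      have "card {l. l < k} < card {l. l < j}"
        using that by (intro psubset_card_mono) auto
      with less show ?thesis by blast
    qed
    have *: "L $ i $ j * L $ j $ j = M $ i $ j * M $ j $ j" for i
    proof -
      have "(\<Sum>k\<in>{k. k < j}. L $ i $ k * L $ j $ k) + L $ i $ j * L $ j $ j
          = (\<Sum>k\<in>{k. k < j}. M $ i $ k * M $ j $ k) + M $ i $ j * M $ j $ j"
        using expand[OF L(1), of i j] expand[OF M(1), of i j] eq by simp
      then show ?thesis
        by (simp add: IH)
    qed
    have "L $ j $ j = M $ j $ j"
      using *[of j] L(2)[of j] M(2)[of j] by (simp add: power2_eq_square[symmetric] less_imp_le)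
    then show ?case
      using * L(2)[of j] by (metis less_irrefl mult_right_cancel)
  qed
  then show ?thesis
    by (simp add: vec_eq_iff)
qed

lemma cholesky_factorization:
  fixes A :: "real^('n::{finite,linorder})^('n::_)"
  assumes A: "pos_def A"
  shows "cholesky A ** transpose (cholesky A) = A"
proof -
  have "\<exists>!L. (\<forall>i j. i < j \<longrightarrow> L $ i $ j = 0) \<and> (\<forall>i. 0 < L $ i $ i) \<and> L ** transpose L = A"
    using cholesky_exists[OF A] cholesky_unique by blast
  from theI'[OF this] show ?thesis
    by (simp add: cholesky_def)
qed

section \<open>The iteration for a linear forward map\<close>

text \<open>The scaling \<open>uki_a\<close> cancels between the weight and the squared step;
  \<open>0 < real N + \<kappa>\<close> makes it nonzero. The leading 2 counts the two sigma points
  of each column. In consequence \<open>\<kappa>\<close> disappears from the linear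
  iteration.\<close>

lemma uki_weights:
  assumes "0 < real N + \<kappa>" "0 < N"
  shows "2 * (uki_W N \<kappa> * (uki_c N \<kappa>)\<^sup>2) = 1"
proof -
  have "0 < uki_a N \<kappa>"
    using assms by (simp add: uki_a_def)
  then show ?thesis
    using assms by (simp add: uki_W_def uki_c_def power_mult_distrib field_simps)
qed

text \<open>The sigma points \<open>m \<plusminus> c L\<^sub>j\<close> contribute equally, and \<open>2 W c\<^sup>2 = 1\<close>, so the sum is \<open>F L L\<^sup>T G\<^sup>T\<close>.\<close>

lemma sigma_point_sum:
  fixes F :: "real^('n::{finite,linorder}) ^ 'k" and G :: "real^('n::_) ^ 'm"
  assumes \<kappa>: "0 < real CARD('n) + \<kappa>" and C: "pos_def C"
  shows "(\<Sum>j\<in>UNIV. uki_W CARD('n) \<kappa> *\<^sub>R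
      outer (F *v (sigma_point \<kappa> m C j - m)) (G *v (sigma_point \<kappa> m C j - m))) = F ** C ** transpose G"
proof -
  define L where "L = cholesky C"
  define c where "c = uki_c CARD('n) \<kappa>"
  define W where "W = uki_W CARD('n) \<kappa>"
  have W: "2 * (W * c\<^sup>2) = 1"
    using uki_weights[OF \<kappa>] by (simp add: W_def c_def)
  have o: "outer (F *v (s *\<^sub>R x)) (G *v (s *\<^sub>R x)) = s\<^sup>2 *\<^sub>R outer (F *v x) (G *v x)" for s x
    by (simp add: outer_def vec_eq_iff matrix_vector_mult_scaleR power2_eq_square)
  have "(\<Sum>j\<in>UNIV. W *\<^sub>R outer (F *v (sigma_point \<kappa> m C j - m)) (G *v (sigma_point \<kappa> m C j - m)))
     = (\<Sum>j\<in>UNIV. (2 * (W * c\<^sup>2)) *\<^sub>R outer (F *v column j L) (G *v column j L))"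
  proof -
    have "sum f UNIV = (\<Sum>j\<in>UNIV. f (Inl j) + f (Inr j))" for f :: "'n + 'n \<Rightarrow> real^'m^'k"
      unfolding UNIV_sum
      by (subst sum.union_disjoint) (auto simp: sum.reindex sum.distrib)
    moreover have "sigma_point \<kappa> m C (Inl j) - m = c *\<^sub>R column j L"
      "sigma_point \<kappa> m C (Inr j) - m = (-c) *\<^sub>R column j L" for j
      by (simp_all add: c_def L_def)
    ultimately show ?thesis
      by (simp only: o) (simp add: scaleR_add_left[symmetric])
  qed
  also have "\<dots> = (\<Sum>j\<in>UNIV. outer (F *v column j L) (G *v column j L))"
    by (simp add: W)
  also have "\<dots> = (F ** L) ** transpose (G ** L)"
    by (simp add: outer_def vec_eq_iff matrix_matrix_mult_def transpose_def column_def matrix_vector_mult_def)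
  also have "\<dots> = F ** (L ** transpose L) ** transpose G"
    by (simp add: matrix_transpose_mul matrix_mul_assoc)
  also have "L ** transpose L = C"
    unfolding L_def by (rule cholesky_factorization[OF C])
  finally show ?thesis
    by (simp add: W_def)
qed

declare transpose_matrix_vector [simp del]

lemma inner_transpose_mult:
  fixes F :: "real^'n^'m"
  shows "x \<bullet> (transpose F *v v) = (F *v x) \<bullet> v"
  by (simp add: inner_matrix_vector_mult)

lemma pos_def_congruence:
  fixes F :: "real^'n^'m"
  assumes A: "pos_def A" and F: "inj ((*v) F)"
  shows "pos_def (transpose F ** A ** F)"
proof (rule pos_defI)
  show "x \<bullet> ((transpose F ** A ** F) *v y) = ((transpose F ** A ** F) *v x) \<bullet> y" for x y
    by (simp add: matrix_vector_mul_assoc[symmetric] inner_transpose_mult pos_def_symmetric[OF A])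
      (simp add: inner_matrix_vector_mult)
next
  fix x :: "real^'n" assume "x \<noteq> 0"
  then have "F *v x \<noteq> 0"
    using F by (metis injD matrix_vector_mult_0_right)
  then show "0 < x \<bullet> ((transpose F ** A ** F) *v x)"
    using pos_def_pos[OF A]
    by (simp add: matrix_vector_mul_assoc[symmetric] inner_transpose_mult)
qed

text \<open>By Cauchy-Schwarz. This bounds the inverse of \<open>A\<close> by \<open>1 / l\<close>
  in a form that can be applied vector by vector.\<close>

lemma coercive_norm_le:
  fixes A :: "real^'n^'n"
  assumes l: "0 < l" "\<And>x. l * (norm x)\<^sup>2 \<le> x \<bullet> (A *v x)"
  shows "l * norm x \<le> norm (A *v x)"
proof (cases "x = 0")
  case False
  have "l * (norm x)\<^sup>2 \<le> norm x * norm (A *v x)"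
    using l(2)[of x] norm_cauchy_schwarz[of x "A *v x"] by linarith
  then show ?thesis
    using False by (simp add: power2_eq_square)
qed auto

lemma exp_converges_halfI:
  assumes "\<And>n. norm (x n - l) \<le> K * (1/2)^n"
  shows "exp_converges x l"
proof -
  \<comment> \<open>\<open>exp_converges\<close> asks for a strictly positive constant, whereas
    \<open>K\<close> may be zero, for instance if the iteration starts at its limit.\<close>
  have "norm (x n - l) \<le> (\<bar>K\<bar> + 1) * (1/2)^n" for n
    by (rule order_trans[OF assms]) (simp add: mult_right_mono)
  then show ?thesis
    unfolding exp_converges_def by (intro exI[of _ "\<bar>K\<bar> + 1"] exI[of _ "1/2"]) auto
qed

locale linear_inverse_problem =
  fixes G :: "real^('n::{finite,linorder})^'m" and \<Sigma> :: "real^'m^'m"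
  assumes \<Sigma>: "pos_def \<Sigma>" and full_rank: "rank G = CARD('n)"
begin

section \<open>Weighted least squares and the normal equation\<close>

text \<open>The Hessian of the misfit; its inverse is the limiting covariance.\<close>

definition precision :: "real^('n::_)^('n::_)" where
  "precision = transpose G ** matrix_inv \<Sigma> ** G"

text \<open>The solution of the normal equation, that is, the weighted least squares estimator. It
  is a function of the data because the observation is random in the coverage statement.\<close>

definition estimate :: "real^'m \<Rightarrow> real^('n::_)" where
  "estimate y = matrix_inv precision *v (transpose G *v (matrix_inv \<Sigma> *v y))"

lemma pos_def_precision: "pos_def precision"
  unfolding precision_def
  using pos_def_congruence[OF pos_def_matrix_inv[OF \<Sigma>]] full_rank
  by (simp add: full_rank_injective)

lemma precision_mult: "precision *v x = transpose G *v (matrix_inv \<Sigma> *v (G *v x))"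
  by (simp add: precision_def matrix_vector_mul_assoc matrix_mul_assoc)

lemma normal_equation: "transpose G *v (matrix_inv \<Sigma> *v (y - G *v estimate y)) = 0"
  using pos_def_precision
  by (simp add: matrix_vector_mult_diff_distrib precision_mult[symmetric] estimate_def)

text \<open>Completing the square: the cross terms vanish by \<open>normal_equation\<close>. The
  identity yields both the minimizer and the Gaussian shape of the posterior.\<close>

lemma misfit_eq:
  "misfit (\<lambda>\<theta>. G *v \<theta>) \<Sigma> y \<theta> = misfit (\<lambda>\<theta>. G *v \<theta>) \<Sigma> y (estimate y)
     + (\<theta> - estimate y) \<bullet> (precision *v (\<theta> - estimate y)) / 2"
proof -
  define r where "r = y - G *v estimate y"
  define d where "d = \<theta> - estimate y"
  have "(G *v d) \<bullet> (matrix_inv \<Sigma> *v r) = d \<bullet> (transpose G *v (matrix_inv \<Sigma> *v r))"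
    by (simp add: inner_matrix_vector_mult)
  then have 1: "(G *v d) \<bullet> (matrix_inv \<Sigma> *v r) = 0"
    using normal_equation by (simp add: r_def)
  then have 2: "r \<bullet> (matrix_inv \<Sigma> *v (G *v d)) = 0"
    using pos_def_symmetric[OF pos_def_matrix_inv[OF \<Sigma>]] by (metis inner_commute)
  have "y - G *v \<theta> = r - G *v d"
    by (simp add: r_def d_def matrix_vector_mult_diff_distrib)
  moreover have "(G *v d) \<bullet> (matrix_inv \<Sigma> *v (G *v d)) = d \<bullet> (precision *v d)"
    by (simp add: precision_mult inner_matrix_vector_mult)
  then have "(r - G *v d) \<bullet> (matrix_inv \<Sigma> *v (r - G *v d)) = r \<bullet> (matrix_inv \<Sigma> *v r) + d \<bullet> (precision *v d)"
    by (simp add: matrix_vector_mult_diff_distrib inner_diff_left inner_diff_right 1 2)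
  ultimately show ?thesis
    by (simp add: misfit_def norm_matrix_inv_sqrt[OF \<Sigma>] r_def[symmetric] d_def[symmetric])
qed

lemma estimate_is_minimizer: "is_arg_min (misfit (\<lambda>\<theta>. G *v \<theta>) \<Sigma> y) (\<lambda>_. True) (estimate y)"
proof -
  have "misfit (\<lambda>\<theta>. G *v \<theta>) \<Sigma> y (estimate y) \<le> misfit (\<lambda>\<theta>. G *v \<theta>) \<Sigma> y \<theta>" for \<theta>
    using misfit_eq[of y \<theta>] pos_def_nonneg[OF pos_def_precision] by simp
  then show ?thesis
    by (simp add: is_arg_min_def not_less)
qed

text \<open>The estimator is linear and recovers \<open>\<theta>\<close> from the noise-free data
  \<open>G *v \<theta>\<close>, so its error depends on the noise alone.\<close>

lemma estimate_error:
  "\<theta> - estimate y = - (matrix_inv precision *v (transpose G *v (matrix_inv \<Sigma> *v (y - G *v \<theta>))))"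
  using pos_def_precision
  by (simp add: matrix_vector_mult_diff_distrib precision_mult[symmetric] estimate_def)

section \<open>The Kalman update in information form\<close>

text \<open>The Kalman gain for predicted covariance \<open>D\<close> and observation noise
  covariance \<open>2 *\<^sub>R \<Sigma>\<close>.\<close>

definition gain :: "real^('n::_)^('n::_) \<Rightarrow> real^'m^('n::_)" where
  "gain D = D ** transpose G ** matrix_inv (G ** D ** transpose G + 2 *\<^sub>R \<Sigma>)"

text \<open>Increments of the forward map are \<open>G\<close> applied to increments of the sigma
  points, so \<open>sigma_point_sum\<close> evaluates both sums: \<open>F = mat 1\<close> gives the
  cross covariance and \<open>F = G\<close> the covariance of the predicted data.\<close>

lemma uki_step_linear:
  assumes \<kappa>: "0 < real CARD('n) + \<kappa>" and C: "pos_def C"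
  shows "uki_step \<kappa> (\<lambda>\<theta>. G *v \<theta>) \<Sigma> y (m, C)
    = (m + gain (2 *\<^sub>R C) *v (y - G *v m), 2 *\<^sub>R C - gain (2 *\<^sub>R C) ** G ** (2 *\<^sub>R C))"
proof -
  have D: "pos_def (2 *\<^sub>R C)" "C + C = 2 *\<^sub>R C"
    using pos_def_scaleR[OF C, of 2] by (simp_all only: scaleR_2)
  have t: "transpose (2 *\<^sub>R C ** transpose G) = G ** (2 *\<^sub>R C)"
    using D(1) by (simp add: matrix_transpose_mul pos_def_def)
  have 1: "(\<Sum>j\<in>UNIV. uki_W CARD('n) \<kappa> *\<^sub>R
      outer (sigma_point \<kappa> m (2 *\<^sub>R C) j - m) (G *v sigma_point \<kappa> m (2 *\<^sub>R C) j - G *v m)) = 2 *\<^sub>R C ** transpose G"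
    using sigma_point_sum[OF \<kappa> D(1), where F="mat 1" and G=G and m=m]
    by (simp add: matrix_vector_mult_diff_distrib)
  have 2: "(\<Sum>j\<in>UNIV. uki_W CARD('n) \<kappa> *\<^sub>R
      outer (G *v sigma_point \<kappa> m (2 *\<^sub>R C) j - G *v m) (G *v sigma_point \<kappa> m (2 *\<^sub>R C) j - G *v m)) = G ** (2 *\<^sub>R C) ** transpose G"
    using sigma_point_sum[OF \<kappa> D(1), where F=G and G=G and m=m]
    by (simp add: matrix_vector_mult_diff_distrib)
  show ?thesis
    unfolding uki_step_def Let_def split D(2) 1 2 t gain_def
    by (simp add: matrix_mul_assoc)
qed

text \<open>Writing \<open>v = S *v w\<close> with the innovation covariance \<open>S\<close> turns
  the gain term into \<open>2 *\<^sub>R (C *v (transpose G *v w))\<close>. Applying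
  \<open>matrix_inv C + precision\<close> to it gives
  \<open>transpose G *v (matrix_inv \<Sigma> *v (S *v w))\<close>, so the inverse of
  \<open>S\<close> drops out.\<close>

lemma precision_gain:
  assumes C: "pos_def C"
  shows "(matrix_inv C + precision) *v (gain (2 *\<^sub>R C) *v v) = transpose G *v (matrix_inv \<Sigma> *v v)"
proof -
  define S where "S = G ** (2 *\<^sub>R C) ** transpose G + 2 *\<^sub>R \<Sigma>"
  have S_mult: "S *v x = 2 *\<^sub>R (G *v (C *v (transpose G *v x))) + 2 *\<^sub>R (\<Sigma> *v x)" for x
    by (simp add: S_def matrix_vector_mult_add_rdistrib matrix_vector_mul_assoc[symmetric]
        scaleR_matrix_vector_assoc[symmetric] matrix_vector_mult_scaleR)
  have S_inner: "x \<bullet> (S *v z)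
      = 2 * ((transpose G *v x) \<bullet> (C *v (transpose G *v z))) + 2 * (x \<bullet> (\<Sigma> *v z))" for x z
    by (simp add: S_mult inner_add_right inner_matrix_vector_mult[of _ G])
  have "pos_def S"
  proof (rule pos_defI)
    show "x \<bullet> (S *v z) = (S *v x) \<bullet> z" for x z
      using S_inner[of x z] S_inner[of z x] pos_def_symmetric[OF \<Sigma>, of x z]
        pos_def_symmetric[OF C, of "transpose G *v x" "transpose G *v z"]
      by (simp add: inner_commute)
  next
    fix x :: "real^'m" assume "x \<noteq> 0"
    then show "0 < x \<bullet> (S *v x)"
      using pos_def_nonneg[OF C, of "transpose G *v x"] pos_def_pos[OF \<Sigma>, of x]
      by (simp add: S_inner)
  qed
  define w where "w = matrix_inv S *v v"
  have v: "v = S *v w"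
    using \<open>pos_def S\<close> by (simp add: w_def)
  have "gain (2 *\<^sub>R C) *v v = 2 *\<^sub>R (C *v (transpose G *v w))"
    by (simp add: gain_def S_def[symmetric] w_def matrix_vector_mul_assoc[symmetric]
        scaleR_matrix_vector_assoc[symmetric])
  then show ?thesis
    using C \<Sigma>
    by (simp add: v S_mult matrix_vector_mult_add_rdistrib precision_mult algebra_simps)
qed

lemma uki_step_precision:
  assumes \<kappa>: "0 < real CARD('n) + \<kappa>" and C: "pos_def C"
    and step: "uki_step \<kappa> (\<lambda>\<theta>. G *v \<theta>) \<Sigma> y (m, C) = (m', C')"
  shows "pos_def C'" "matrix_inv C' = (1/2) *\<^sub>R (matrix_inv C + precision)"
    "matrix_inv C' *v (m' - estimate y) = (1/2) *\<^sub>R (matrix_inv C *v (m - estimate y))"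
proof -
  define P where "P = (1/2) *\<^sub>R (matrix_inv C + precision)"
  have P: "pos_def P"
    using C by (simp add: P_def pos_def_scaleR pos_def_add pos_def_matrix_inv pos_def_precision)
  have m': "m' = m + gain (2 *\<^sub>R C) *v (y - G *v m)"
    and C': "C' = 2 *\<^sub>R C - gain (2 *\<^sub>R C) ** G ** (2 *\<^sub>R C)"
    using step uki_step_linear[OF \<kappa> C] by auto
  have Pgain: "P *v (gain (2 *\<^sub>R C) *v v) = (1/2) *\<^sub>R (transpose G *v (matrix_inv \<Sigma> *v v))" for v
    using precision_gain[OF C] by (simp add: P_def scaleR_matrix_vector_assoc[symmetric])
  \<comment> \<open>\<open>P\<close> maps \<open>2 *\<^sub>R (C *v v)\<close> to
    \<open>v + precision *v (C *v v)\<close>, and by \<open>Pgain\<close> the subtracted correction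
    contributes exactly \<open>precision *v (C *v v)\<close>.\<close>
  have "P *v (C' *v v) = v" for v
    using C
    by (simp add: C' matrix_vector_mult_diff_rdistrib matrix_vector_mul_assoc[symmetric]
        matrix_vector_mult_diff_distrib Pgain)
      (simp add: P_def matrix_vector_mult_add_rdistrib precision_mult algebra_simps
        scaleR_matrix_vector_assoc[symmetric])
  then have PC': "P ** C' = mat 1"
    by (simp add: matrix_eq matrix_vector_mul_assoc[symmetric])
  then have "C' = matrix_inv P"
    by (simp add: matrix_inv_unique)
  then show "pos_def C'"
    using P by (simp add: pos_def_matrix_inv)
  from PC' have inv: "matrix_inv C' = P"
    by (intro matrix_inv_unique) (simp add: matrix_left_right_inverse)
  then show "matrix_inv C' = (1/2) *\<^sub>R (matrix_inv C + precision)"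
    by (simp add: P_def)
  have "2 *\<^sub>R (P *v (m' - estimate y)) = matrix_inv C *v (m - estimate y) + precision *v (m - estimate y)
     + transpose G *v (matrix_inv \<Sigma> *v (y - G *v m))"
  proof -
    have "m' - estimate y = (m - estimate y) + gain (2 *\<^sub>R C) *v (y - G *v m)"
      by (simp add: m')
    then show ?thesis
      by (simp only: matrix_vector_right_distrib Pgain)
        (simp add: P_def matrix_vector_mult_add_rdistrib scaleR_matrix_vector_assoc[symmetric]
          scaleR_add_right)
  qed
  \<comment> \<open>The precision term and the data term combine into the residual of the estimate,
    which \<open>normal_equation\<close> annihilates.\<close>
  also have "precision *v (m - estimate y) + transpose G *v (matrix_inv \<Sigma> *v (y - G *v m)) =
      transpose G *v (matrix_inv \<Sigma> *v (y - G *v estimate y))"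
    by (simp add: precision_mult matrix_vector_mult_diff_distrib)
  then have "matrix_inv C *v (m - estimate y) + precision *v (m - estimate y)
     + transpose G *v (matrix_inv \<Sigma> *v (y - G *v m)) = matrix_inv C *v (m - estimate y)"
    by (simp add: normal_equation add.assoc)
  finally have two: "2 *\<^sub>R (P *v (m' - estimate y)) = matrix_inv C *v (m - estimate y)" .
  then show "matrix_inv C' *v (m' - estimate y) = (1/2) *\<^sub>R (matrix_inv C *v (m - estimate y))"
    unfolding inv by (simp flip: two)
qed

section \<open>Closed form of the iteration and rates of convergence\<close>

text \<open>The recursions of \<open>uki_step_precision\<close> halve both deviations at every step.
  Positive definiteness is carried along in the induction because each step presupposes it.\<close>

lemma uki_closed_form:
  fixes m\<^sub>0 :: "real^('n::_)" and y :: "real^'m"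
  assumes \<kappa>: "0 < real CARD('n) + \<kappa>" and C0: "pos_def C\<^sub>0"
  defines "x \<equiv> uki \<kappa> (\<lambda>\<theta>. G *v \<theta>) \<Sigma> y m\<^sub>0 C\<^sub>0"
  shows "pos_def (snd (x n))
    \<and> matrix_inv (snd (x n)) = (1 - (1/2)^n) *\<^sub>R precision + (1/2)^n *\<^sub>R matrix_inv C\<^sub>0
    \<and> matrix_inv (snd (x n)) *v (fst (x n) - estimate y) = (1/2)^n *\<^sub>R (matrix_inv C\<^sub>0 *v (m\<^sub>0 - estimate y))"
proof (induction n)
  case 0
  then show ?case
    using C0 by (simp add: x_def uki_def)
next
  case (Suc n)
  obtain m C m' C' where eq: "x n = (m, C)" "x (Suc n) = (m', C')"
    by (metis surj_pair)
  have step: "uki_step \<kappa> (\<lambda>\<theta>. G *v \<theta>) \<Sigma> y (m, C) = (m', C')"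
    using eq by (simp add: x_def uki_def)
  have C: "pos_def C" using Suc eq by simp
  have half: "(1/2) *\<^sub>R (((1 - t) *\<^sub>R P + t *\<^sub>R Q) + P) = (1 - t / 2) *\<^sub>R P + (t / 2) *\<^sub>R Q"
    for t :: real and P Q :: "real^('n::_)^('n::_)"
    by (simp add: vec_eq_iff field_simps)
  note IH = Suc[unfolded eq fst_conv snd_conv]
  have "matrix_inv C' = (1 - (1/2)^n / 2) *\<^sub>R precision + ((1/2)^n / 2) *\<^sub>R matrix_inv C\<^sub>0"
    unfolding uki_step_precision(2)[OF \<kappa> C step] IH[THEN conjunct2, THEN conjunct1] by (rule half)
  moreover have "matrix_inv C' *v (m' - estimate y) = ((1/2)^n / 2) *\<^sub>R (matrix_inv C\<^sub>0 *v (m\<^sub>0 - estimate y))"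
    unfolding uki_step_precision(3)[OF \<kappa> C step] IH[THEN conjunct2, THEN conjunct2] by simp
  ultimately show ?case
    using uki_step_precision(1)[OF \<kappa> C step] by (simp add: eq)
qed

text \<open>The inverse covariances are convex combinations of the two fixed matrices
  \<open>precision\<close> and \<open>matrix_inv C\<^sub>0\<close>, so the smaller of their
  coercivity constants serves for all \<open>n\<close>.\<close>

lemma uki_precision_coercive:
  assumes \<kappa>: "0 < real CARD('n) + \<kappa>" and C0: "pos_def C\<^sub>0"
  obtains l where "0 < l"
    "\<And>n x. l * norm x \<le> norm (matrix_inv (snd (uki \<kappa> (\<lambda>\<theta>. G *v \<theta>) \<Sigma> y m\<^sub>0 C\<^sub>0 n)) *v x)"
proof -
  obtain b where b: "0 < b" "\<And>x. b * (norm x)\<^sup>2 \<le> x \<bullet> (precision *v x)"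
    using pos_def_coercive[OF pos_def_precision] by blast
  obtain c where c: "0 < c" "\<And>x. c * (norm x)\<^sup>2 \<le> x \<bullet> (matrix_inv C\<^sub>0 *v x)"
    using pos_def_coercive[OF pos_def_matrix_inv[OF C0]] by blast
  have "min b c * norm x \<le> norm (matrix_inv (snd (uki \<kappa> (\<lambda>\<theta>. G *v \<theta>) \<Sigma> y m\<^sub>0 C\<^sub>0 n)) *v x)" for n x
  proof (rule coercive_norm_le)
    fix x :: "real^('n::_)"
    define t where "t = (1/2::real)^n"
    have t: "0 \<le> t" "t \<le> 1"
      by (simp_all add: t_def power_le_one)
    have "min b c * (norm x)\<^sup>2 \<le> b * (norm x)\<^sup>2" "min b c * (norm x)\<^sup>2 \<le> c * (norm x)\<^sup>2"
      by (auto intro: mult_right_mono)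
    then have "min b c * (norm x)\<^sup>2 \<le> x \<bullet> (precision *v x)" "min b c * (norm x)\<^sup>2 \<le> x \<bullet> (matrix_inv C\<^sub>0 *v x)"
      using b(2)[of x] c(2)[of x] by linarith+
    then have "(1 - t) * (min b c * (norm x)\<^sup>2) + t * (min b c * (norm x)\<^sup>2)
       \<le> (1 - t) * (x \<bullet> (precision *v x)) + t * (x \<bullet> (matrix_inv C\<^sub>0 *v x))"
      using t by (intro add_mono mult_left_mono) auto
    then show "min b c * (norm x)\<^sup>2 \<le> x \<bullet> (matrix_inv (snd (uki \<kappa> (\<lambda>\<theta>. G *v \<theta>) \<Sigma> y m\<^sub>0 C\<^sub>0 n)) *v x)"
      unfolding uki_closed_form[OF \<kappa> C0, of y m\<^sub>0 n, THEN conjunct2, THEN conjunct1] t_def[symmetric]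
      by (simp add: matrix_vector_mult_add_rdistrib inner_add_right
          scaleR_matrix_vector_assoc[symmetric]) (simp add: left_diff_distrib)
  qed (use b c in auto)
  moreover have "0 < min b c" using b c by simp
  ultimately show thesis using that by blast
qed

text \<open>The inverse covariance applied to the error is \<open>(1/2)^n\<close> times a fixed
  vector, and uniform coercivity passes this rate on to the error itself.\<close>

lemma uki_mean_converges:
  assumes \<kappa>: "0 < real CARD('n) + \<kappa>" and C0: "pos_def C\<^sub>0"
  shows "exp_converges (\<lambda>n. fst (uki \<kappa> (\<lambda>\<theta>. G *v \<theta>) \<Sigma> y m\<^sub>0 C\<^sub>0 n)) (estimate y)"
proof -
  obtain l where l: "0 < l"
    "\<And>n x. l * norm x \<le> norm (matrix_inv (snd (uki \<kappa> (\<lambda>\<theta>. G *v \<theta>) \<Sigma> y m\<^sub>0 C\<^sub>0 n)) *v x)"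
    using uki_precision_coercive[OF assms, of y m\<^sub>0] by blast
  show ?thesis
  proof (rule exp_converges_halfI)
    fix n
    have "l * norm (fst (uki \<kappa> (\<lambda>\<theta>. G *v \<theta>) \<Sigma> y m\<^sub>0 C\<^sub>0 n) - estimate y)
        \<le> (1/2)^n * norm (matrix_inv C\<^sub>0 *v (m\<^sub>0 - estimate y))"
      using l(2)[of "fst (uki \<kappa> (\<lambda>\<theta>. G *v \<theta>) \<Sigma> y m\<^sub>0 C\<^sub>0 n) - estimate y" n]
        uki_closed_form[OF assms, of y m\<^sub>0 n, THEN conjunct2, THEN conjunct2] by simp
    then show "norm (fst (uki \<kappa> (\<lambda>\<theta>. G *v \<theta>) \<Sigma> y m\<^sub>0 C\<^sub>0 n) - estimate y)
        \<le> norm (matrix_inv C\<^sub>0 *v (m\<^sub>0 - estimate y)) / l * (1/2)^n"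
      using l(1) by (simp add: field_simps)
  qed
qed

text \<open>Multiplying \<open>C n - matrix_inv precision\<close> by \<open>matrix_inv (C n)\<close>
  leaves \<open>(1/2)^n\<close> times a fixed matrix; coercivity is then applied column by
  column.\<close>

lemma uki_covariance_converges:
  assumes \<kappa>: "0 < real CARD('n) + \<kappa>" and C0: "pos_def C\<^sub>0"
  shows "exp_converges (\<lambda>n. snd (uki \<kappa> (\<lambda>\<theta>. G *v \<theta>) \<Sigma> y m\<^sub>0 C\<^sub>0 n)) (matrix_inv precision)"
proof -
  define C where "C n = snd (uki \<kappa> (\<lambda>\<theta>. G *v \<theta>) \<Sigma> y m\<^sub>0 C\<^sub>0 n)" for n
  obtain l where l: "0 < l" "\<And>n x. l * norm x \<le> norm (matrix_inv (C n) *v x)"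
    using uki_precision_coercive[OF assms, of y m\<^sub>0] by (auto simp: C_def)
  have C: "pos_def (C n)" "matrix_inv (C n) = (1 - (1/2)^n) *\<^sub>R precision + (1/2)^n *\<^sub>R matrix_inv C\<^sub>0" for n
    using uki_closed_form[OF assms, of y m\<^sub>0 n] by (simp_all add: C_def)
  \<comment> \<open>Column \<open>i\<close> of that fixed matrix,
    \<open>mat 1 - matrix_inv C\<^sub>0 ** matrix_inv precision\<close>.\<close>
  define e where "e i = precision *v (matrix_inv precision *v axis i 1)
      - matrix_inv C\<^sub>0 *v (matrix_inv precision *v axis i 1)" for i
  have bound: "l * norm (C n *v axis i 1 - matrix_inv precision *v axis i 1) \<le> norm (e i) * (1/2)^n" for n i
  proof -
    have "matrix_inv (C n) *v (C n *v axis i 1 - matrix_inv precision *v axis i 1) = (1/2)^n *\<^sub>R e i"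
    proof -
      have "matrix_inv (C n) *v (matrix_inv precision *v axis i 1)
          = axis i 1 - (1/2)^n *\<^sub>R axis i 1 + (1/2)^n *\<^sub>R (matrix_inv C\<^sub>0 *v (matrix_inv precision *v axis i 1))"
        using pos_def_precision
        by (simp add: C(2) matrix_vector_mult_add_rdistrib scaleR_matrix_vector_assoc[symmetric]
            scaleR_diff_left matrix_vector_mult_diff_rdistrib)
      then show ?thesis
        using C(1)[of n] pos_def_precision
        by (simp add: matrix_vector_mult_diff_distrib e_def scaleR_diff_right)
    qed
    then show ?thesis
      using l(2)[of "C n *v axis i 1 - matrix_inv precision *v axis i 1" n] by (simp add: mult.commute)
  qed
  have "norm (C n - matrix_inv precision) \<le> (\<Sum>i\<in>UNIV. norm (e i)) / l * (1/2)^n" for n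
  proof -
    \<comment> \<open>The norm of a matrix is built from its rows, while the bounds concern columns;
      symmetry identifies the two.\<close>
    have row: "(C n - matrix_inv precision) $ i = C n *v axis i 1 - matrix_inv precision *v axis i 1" for i
    proof -
      have "transpose (C n) = C n" "transpose (matrix_inv precision) = matrix_inv precision"
        using C(1) pos_def_matrix_inv[OF pos_def_precision] by (simp_all add: pos_def_def)
      then have "C n $ k $ i = C n $ i $ k" "matrix_inv precision $ k $ i = matrix_inv precision $ i $ k" for k
        by (simp_all add: transpose_def vec_eq_iff)
      then show ?thesis
        by (simp add: matrix_vector_mult_basis column_def vec_eq_iff)
    qed
    have "norm (C n - matrix_inv precision) \<le> (\<Sum>i\<in>UNIV. norm ((C n - matrix_inv precision) $ i))"
      unfolding norm_vec_def by (rule L2_set_le_sum) simp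
    also have "\<dots> \<le> (\<Sum>i\<in>UNIV. norm (e i) * (1/2)^n / l)"
      unfolding row using bound l(1) by (intro sum_mono) (simp add: field_simps)
    finally show ?thesis
      by (simp add: sum_distrib_right sum_divide_distrib)
  qed
  then show ?thesis
    unfolding C_def[symmetric] by (rule exp_converges_halfI)
qed

end

section \<open>Gaussian measures\<close>

lemma continuous_on_matrix_vector_mult:
  fixes A :: "real^'n^'m"
  shows "continuous_on S f \<Longrightarrow> continuous_on S (\<lambda>x. A *v f x)"
  by (rule bounded_linear.continuous_on[OF matrix_vector_mul_bounded_linear])

section \<open>Translation invariance and one-dimensional Gaussian marginals\<close>

lemma nn_integral_lborel_translation:
  fixes f :: "'a::euclidean_space \<Rightarrow> ennreal"
  assumes [measurable]: "f \<in> borel_measurable borel"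
  shows "(\<integral>\<^sup>+x. f (c + x) \<partial>lborel) = (\<integral>\<^sup>+x. f x \<partial>lborel)"
  using nn_integral_distr[of "(+) c" lborel borel f] by (simp add: lborel_distr_plus)

lemma nn_integral_lborel_reflection:
  fixes f :: "'a::euclidean_space \<Rightarrow> ennreal"
  assumes [measurable]: "f \<in> borel_measurable borel"
  shows "(\<integral>\<^sup>+x. f (c - x) \<partial>lborel) = (\<integral>\<^sup>+x. f x \<partial>lborel)"
proof -
  have "lborel = distr lborel borel (\<lambda>x. c + (-1) *\<^sub>R (x::'a))"
    using lborel_affine[of "-1" c] by (simp add: density_1)
  then have "(\<integral>\<^sup>+x. f x \<partial>lborel) = (\<integral>\<^sup>+x. f x \<partial>distr lborel borel (\<lambda>x. c + (-1) *\<^sub>R (x::'a)))"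
    by simp
  also have "\<dots> = (\<integral>\<^sup>+x. f (c - x) \<partial>lborel)"
    by (subst nn_integral_distr) auto
  finally show ?thesis by simp
qed

text \<open>Fubini, applied to \<open>f x * g (x + y)\<close>, where \<open>g\<close> is the indicator of a unit box.\<close>

lemma translation_invariant_measure_unique:
  fixes M :: "'a::euclidean_space measure"
  assumes "sigma_finite_measure M" and sets[measurable_cong]: "sets M = sets borel"
    and inv: "\<And>c f. f \<in> borel_measurable borel \<Longrightarrow> (\<integral>\<^sup>+x. f (c + x) \<partial>M) = (\<integral>\<^sup>+x. f x \<partial>M)"
  shows "\<exists>c. \<forall>f\<in>borel_measurable borel. (\<integral>\<^sup>+x. f x \<partial>M) = c * (\<integral>\<^sup>+x. f x \<partial>lborel)"
proof -
  interpret M: sigma_finite_measure M by fact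
  interpret P: pair_sigma_finite M "lborel :: 'a measure" ..
  define g where "g = (indicator (cbox 0 One) :: 'a \<Rightarrow> ennreal)"
  have [measurable]: "g \<in> borel_measurable borel"
    by (simp add: g_def)
  have g1: "(\<integral>\<^sup>+x. g x \<partial>lborel) = 1"
    by (simp add: g_def nn_integral_indicator emeasure_lborel_cbox)
  have "(\<integral>\<^sup>+x. f x \<partial>M) = (\<integral>\<^sup>+x. g x \<partial>M) * (\<integral>\<^sup>+x. f x \<partial>lborel)"
    if [measurable]: "f \<in> borel_measurable borel" for f
  proof -
    have "(\<integral>\<^sup>+x. f x \<partial>M) = (\<integral>\<^sup>+x. \<integral>\<^sup>+y. f x * g (x + y) \<partial>lborel \<partial>M)"
      by (simp add: nn_integral_cmult nn_integral_lborel_translation g1)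
    also have "\<dots> = (\<integral>\<^sup>+y. \<integral>\<^sup>+x. f x * g (x + y) \<partial>M \<partial>lborel)"
      by (subst P.Fubini') auto
    \<comment> \<open>Invariance of \<open>M\<close> moves \<open>y\<close> from \<open>g\<close> to
      \<open>f\<close>; after the next exchange the inner integral over \<open>y\<close> is a
      reflected Lebesgue integral, independent of \<open>x\<close>.\<close>
    also have "\<dots> = (\<integral>\<^sup>+y. \<integral>\<^sup>+x. f (x - y) * g x \<partial>M \<partial>lborel)"
    proof (rule nn_integral_cong)
      fix y :: 'a
      show "(\<integral>\<^sup>+x. f x * g (x + y) \<partial>M) = (\<integral>\<^sup>+x. f (x - y) * g x \<partial>M)"
        using inv[of "\<lambda>x. f (x - y) * g x" y] by (simp add: add.commute)
    qed
    also have "\<dots> = (\<integral>\<^sup>+x. \<integral>\<^sup>+y. f (x - y) * g x \<partial>lborel \<partial>M)"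
      by (subst P.Fubini') auto
    also have "\<dots> = (\<integral>\<^sup>+x. g x \<partial>M) * (\<integral>\<^sup>+x. f x \<partial>lborel)"
      by (simp add: nn_integral_multc nn_integral_lborel_reflection nn_integral_cmult) (rule mult.commute)
    finally show ?thesis .
  qed
  then show ?thesis by blast
qed

text \<open>Translating \<open>x\<close> along \<open>matrix_inv P *v u\<close> multiplies the Gaussian density by a function of \<open>x \<bullet> u\<close>
  alone. Hence the law of the marginal, weighted with \<open>exp (t\<^sup>2 / (2 v))\<close>, is translation invariant.\<close>

lemma gaussian_marginal:
  fixes P :: "real^'k^'k" and Y :: "'a \<Rightarrow> real^'k"
  assumes "prob_space M" and P: "pos_def P" and u: "u \<noteq> 0"
    and Y: "distributed M lborel Y (\<lambda>x. ennreal (k * exp (- ((x - m) \<bullet> (P *v (x - m))) / 2)))"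
  shows "distributed M lborel (\<lambda>\<omega>. (Y \<omega> - m) \<bullet> u) (normal_density 0 (sqrt (u \<bullet> (matrix_inv P *v u))))"
proof -
  interpret prob_space M by fact
  define v where "v = u \<bullet> (matrix_inv P *v u)"
  have v: "0 < v"
    unfolding v_def by (rule pos_def_pos[OF pos_def_matrix_inv[OF P] u])
  define X where "X \<omega> = (Y \<omega> - m) \<bullet> u" for \<omega>
  have [measurable]: "Y \<in> borel_measurable M"
    using distributed_measurable[OF Y] by simp
  have X[measurable]: "X \<in> borel_measurable M"
    unfolding X_def by measurable
  \<comment> \<open>The exponent of the density plus the exponent of the weight; it is constant
    along \<open>matrix_inv P *v u\<close>.\<close>
  define \<phi> where "\<phi> x = - ((x - m) \<bullet> (P *v (x - m))) / 2 + ((x - m) \<bullet> u)\<^sup>2 / (2 * v)" for x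
  have \<phi>_inv: "\<phi> ((s / v) *\<^sub>R (matrix_inv P *v u) + x) = \<phi> x" for s x
  proof -
    define b where "b = matrix_inv P *v u"
    define z where "z = x - m"
    have Pb: "P *v b = u"
      using P by (simp add: b_def)
    have bu: "b \<bullet> u = v"
      by (simp add: b_def v_def inner_commute)
    have bz: "b \<bullet> (P *v z) = z \<bullet> u"
      using pos_def_symmetric[OF P, of b z] by (simp add: Pb inner_commute)
    have "((s / v) *\<^sub>R b + z) \<bullet> (P *v ((s / v) *\<^sub>R b + z)) = z \<bullet> (P *v z) + 2 * (s / v) * (z \<bullet> u) + (s / v)\<^sup>2 * v"
      by (simp add: matrix_vector_right_distrib matrix_vector_mult_scaleR Pb inner_add_left inner_add_right
          bu bz power2_eq_square algebra_simps)
    moreover have "((s / v) *\<^sub>R b + z) \<bullet> u = s + z \<bullet> u"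
      using v by (simp add: inner_add_left bu)
    moreover have "(s / v) *\<^sub>R b + x - m = (s / v) *\<^sub>R b + z"
      by (simp add: z_def)
    ultimately have "\<phi> ((s / v) *\<^sub>R b + x)
      = - (z \<bullet> (P *v z) + 2 * (s / v) * (z \<bullet> u) + (s / v)\<^sup>2 * v) / 2 + (s + z \<bullet> u)\<^sup>2 / (2 * v)"
      by (simp only: \<phi>_def)
    also have "\<dots> = - (z \<bullet> (P *v z)) / 2 + (z \<bullet> u)\<^sup>2 / (2 * v)"
      using v by (simp add: power2_eq_square field_simps)
    finally show ?thesis
      by (simp add: \<phi>_def b_def z_def)
  qed
  define N where "N = density (distr M borel X) (\<lambda>t. ennreal (exp (t\<^sup>2 / (2 * v))))"
  have N_eq: "(\<integral>\<^sup>+t. f t \<partial>N) = (\<integral>\<^sup>+x. ennreal k * ennreal (exp (\<phi> x)) * f ((x - m) \<bullet> u) \<partial>lborel)"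
    if [measurable]: "f \<in> borel_measurable borel" for f
  proof -
    have "(\<integral>\<^sup>+t. f t \<partial>N) = (\<integral>\<^sup>+\<omega>. ennreal (exp (((Y \<omega> - m) \<bullet> u)\<^sup>2 / (2 * v))) * f ((Y \<omega> - m) \<bullet> u) \<partial>M)"
      by (simp add: N_def nn_integral_density nn_integral_distr X_def)
    also have "\<dots> = (\<integral>\<^sup>+x. ennreal (k * exp (- ((x - m) \<bullet> (P *v (x - m))) / 2))
         * (ennreal (exp (((x - m) \<bullet> u)\<^sup>2 / (2 * v))) * f ((x - m) \<bullet> u)) \<partial>lborel)"
      by (rule distributed_nn_integral[OF Y, symmetric]) measurable
    also have "\<dots> = (\<integral>\<^sup>+x. ennreal k * ennreal (exp (\<phi> x)) * f ((x - m) \<bullet> u) \<partial>lborel)"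
    proof (rule nn_integral_cong)
      fix x
      have "exp (\<phi> x) = exp (- ((x - m) \<bullet> (P *v (x - m))) / 2) * exp (((x - m) \<bullet> u)\<^sup>2 / (2 * v))"
        unfolding \<phi>_def exp_add ..
      then show "ennreal (k * exp (- ((x - m) \<bullet> (P *v (x - m))) / 2))
         * (ennreal (exp (((x - m) \<bullet> u)\<^sup>2 / (2 * v))) * f ((x - m) \<bullet> u))
         = ennreal k * ennreal (exp (\<phi> x)) * f ((x - m) \<bullet> u)"
        by (simp add: ennreal_mult'' mult.assoc)
    qed
    finally show ?thesis .
  qed
  \<comment> \<open>\<open>N\<close> has infinite mass, but a density with finite values over a
    probability measure is sigma-finite.\<close>
  have "sigma_finite_measure N"
  proof -
    interpret D: prob_space "distr M borel X"
      by (rule prob_space_distr) simp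
    show ?thesis
      unfolding N_def by (subst D.sigma_finite_iff_density_finite) auto
  qed
  moreover have "sets N = sets borel"
    by (simp add: N_def)
  moreover have "(\<integral>\<^sup>+t. f (s + t) \<partial>N) = (\<integral>\<^sup>+t. f t \<partial>N)" if [measurable]: "f \<in> borel_measurable borel" for s f
  proof -
    \<comment> \<open>The translation that raises \<open>x \<bullet> u\<close> by \<open>s\<close>
      while preserving \<open>\<phi>\<close>.\<close>
    define d where "d = (s / v) *\<^sub>R (matrix_inv P *v u)"
    have "d \<bullet> u = s"
      using v by (simp add: d_def v_def inner_commute)
    then have d: "(d + x - m) \<bullet> u = s + (x - m) \<bullet> u" for x
      by (simp add: inner_add_left inner_diff_left)
    have [measurable]: "\<phi> \<in> borel_measurable borel"
      unfolding \<phi>_def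
      by (intro borel_measurable_continuous_onI continuous_intros continuous_on_matrix_vector_mult)
        (use v in auto)
    have "(\<integral>\<^sup>+t. f (s + t) \<partial>N)
      = (\<integral>\<^sup>+x. ennreal k * ennreal (exp (\<phi> (d + x))) * f ((d + x - m) \<bullet> u) \<partial>lborel)"
      by (subst N_eq) (simp_all add: d \<phi>_inv[of s, folded d_def])
    also have "\<dots> = (\<integral>\<^sup>+x. ennreal k * ennreal (exp (\<phi> x)) * f ((x - m) \<bullet> u) \<partial>lborel)"
      by (rule nn_integral_lborel_translation) measurable
    also have "\<dots> = (\<integral>\<^sup>+t. f t \<partial>N)"
      by (simp add: N_eq)
    finally show ?thesis .
  qed
  ultimately obtain c where c: "\<And>f. f \<in> borel_measurable borel \<Longrightarrow> (\<integral>\<^sup>+x. f x \<partial>N) = c * (\<integral>\<^sup>+x. f x \<partial>lborel)"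
    using translation_invariant_measure_unique[of N] by blast
  define r where "r = sqrt (2 * pi * v)"
  have r: "0 < r"
    using v by (simp add: r_def)
  have dist_eq: "(\<integral>\<^sup>+t. f t \<partial>distr M borel X)
      = c * ennreal r * (\<integral>\<^sup>+t. ennreal (normal_density 0 (sqrt v) t) * f t \<partial>lborel)"
    if [measurable]: "f \<in> borel_measurable borel" for f
  proof -
    have "(\<integral>\<^sup>+t. f t \<partial>distr M borel X) = (\<integral>\<^sup>+t. ennreal (exp (- t\<^sup>2 / (2 * v))) * f t \<partial>N)"
      unfolding N_def
      by (subst nn_integral_density)
        (auto intro!: nn_integral_cong simp: mult.assoc[symmetric] ennreal_mult''[symmetric] exp_add[symmetric])
    also have "\<dots> = c * (\<integral>\<^sup>+t. ennreal (exp (- t\<^sup>2 / (2 * v))) * f t \<partial>lborel)"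
      by (rule c) measurable
    also have "(\<integral>\<^sup>+t. ennreal (exp (- t\<^sup>2 / (2 * v))) * f t \<partial>lborel)
      = (\<integral>\<^sup>+t. ennreal r * (ennreal (normal_density 0 (sqrt v) t) * f t) \<partial>lborel)"
      using r v
      by (intro nn_integral_cong)
        (simp add: normal_density_def mult.assoc[symmetric] ennreal_mult'[symmetric] r_def[symmetric])
    finally show ?thesis
      by (simp add: nn_integral_cmult mult.assoc)
  qed
  \<comment> \<open>Both laws have total mass one, which determines the constant without reference
    to \<open>k\<close>.\<close>
  have "c * ennreal r = 1"
  proof -
    interpret D: prob_space "distr M borel X"
      by (rule prob_space_distr) simp
    have "(\<integral>\<^sup>+t. ennreal (normal_density 0 (sqrt v) t) \<partial>lborel) = 1"
      using v by (subst nn_integral_eq_integral) auto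
    then show ?thesis
      using dist_eq[of "\<lambda>_. 1"] D.emeasure_space_1 by simp
  qed
  have "distr M lborel X = density lborel (normal_density 0 (sqrt v))"
  proof (rule measure_eqI)
    fix A assume "A \<in> sets (distr M lborel X)"
    then have A[measurable]: "A \<in> sets borel" by simp
    have "emeasure (distr M lborel X) A = (\<integral>\<^sup>+t. indicator A t \<partial>distr M borel X)"
      by (simp add: emeasure_distr)
    also have "\<dots> = emeasure (density lborel (normal_density 0 (sqrt v))) A"
      by (subst dist_eq) (simp_all add: \<open>c * ennreal r = 1\<close> emeasure_density)
    finally show "emeasure (distr M lborel X) A = emeasure (density lborel (normal_density 0 (sqrt v))) A" .
  qed simp
  then show ?thesis
    by (simp add: distributed_def v_def[symmetric] X_def[symmetric, abs_def])
qed

section \<open>Moments, normalization and posterior covariance\<close>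

text \<open>The moments are those of the univariate normal marginal. The case \<open>u = 0\<close>
  is separate because that marginal is a point mass without density; there all claims are
  trivial.\<close>

lemma gaussian_marginal_moments:
  fixes P :: "real^'k^'k" and Y :: "'a \<Rightarrow> real^'k"
  assumes M: "prob_space M" and P: "pos_def P"
    and Y: "distributed M lborel Y (\<lambda>x. ennreal (k * exp (- ((x - m) \<bullet> (P *v (x - m))) / 2)))"
  shows "integrable M (\<lambda>\<omega>. (Y \<omega> - m) \<bullet> u)" "(\<integral>\<omega>. (Y \<omega> - m) \<bullet> u \<partial>M) = 0"
    "integrable M (\<lambda>\<omega>. ((Y \<omega> - m) \<bullet> u)\<^sup>2)"
    "(\<integral>\<omega>. ((Y \<omega> - m) \<bullet> u)\<^sup>2 \<partial>M) = u \<bullet> (matrix_inv P *v u)"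
proof -
  interpret prob_space M by fact
  let ?X = "\<lambda>\<omega>. (Y \<omega> - m) \<bullet> u"
  define v where "v = u \<bullet> (matrix_inv P *v u)"
  have "integrable M ?X \<and> (\<integral>\<omega>. ?X \<omega> \<partial>M) = 0 \<and> integrable M (\<lambda>\<omega>. (?X \<omega>)\<^sup>2) \<and> (\<integral>\<omega>. (?X \<omega>)\<^sup>2 \<partial>M) = v"
  proof (cases "u = 0")
    case False
    have v: "0 < sqrt v"
      using pos_def_pos[OF pos_def_matrix_inv[OF P] False] by (simp add: v_def)
    have D: "distributed M lborel ?X (normal_density 0 (sqrt v))"
      unfolding v_def by (rule gaussian_marginal[OF M P False Y])
    have int: "integrable M (\<lambda>\<omega>. (?X \<omega>)^n)" for n
      using integrable_normal_moment[OF v, of 0 n] distributed_integrable[OF D, of "\<lambda>x. x^n"] by simp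
    have E: "expectation ?X = 0"
      by (rule normal_distributed_expectation[OF v D])
    moreover have "expectation (\<lambda>\<omega>. (?X \<omega>)\<^sup>2) = v"
      using normal_distributed_variance[OF v D] v by (simp add: E)
    ultimately show ?thesis
      using int[of 1] int[of 2] by simp
  qed (simp add: v_def)
  then show "integrable M ?X" "(\<integral>\<omega>. ?X \<omega> \<partial>M) = 0" "integrable M (\<lambda>\<omega>. (?X \<omega>)\<^sup>2)"
    "(\<integral>\<omega>. (?X \<omega>)\<^sup>2 \<partial>M) = u \<bullet> (matrix_inv P *v u)"
    by (simp_all add: v_def)
qed

text \<open>Coercivity dominates the integrand by a product of one-dimensional Gaussians of variance
  \<open>1 / l\<close>, whose integral factorizes over the coordinates.\<close>

lemma nn_integral_gaussian_finite:
  fixes P :: "real^'k^'k"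
  assumes P: "pos_def P"
  shows "(\<integral>\<^sup>+x. ennreal (exp (- ((x - m) \<bullet> (P *v (x - m))) / 2)) \<partial>lborel) < \<infinity>"
proof -
  obtain l where l: "0 < l" "\<And>x. l * (norm x)\<^sup>2 \<le> x \<bullet> (P *v x)"
    using pos_def_coercive[OF P] by blast
  define \<sigma> where "\<sigma> = 1 / sqrt l"
  have \<sigma>: "0 < \<sigma>" "l = 1 / \<sigma>\<^sup>2" using l by (simp_all add: \<sigma>_def power_divide)
  have dens: "exp (- l * (t - \<mu>)\<^sup>2 / 2) = sqrt (2 * pi * \<sigma>\<^sup>2) * normal_density \<mu> \<sigma> t" for t \<mu>
    using \<sigma> by (simp add: normal_density_def)
  have fin: "(\<integral>\<^sup>+t. ennreal (exp (- l * (t - \<mu>)\<^sup>2 / 2)) \<partial>lborel) = ennreal (sqrt (2 * pi * \<sigma>\<^sup>2))" for \<mu>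
    unfolding dens using \<sigma>(1)
    by (subst nn_integral_eq_integral) auto
  have "(\<integral>\<^sup>+x. ennreal (exp (- ((x - m) \<bullet> (P *v (x - m))) / 2)) \<partial>lborel)
     \<le> (\<integral>\<^sup>+x. (\<Prod>b\<in>Basis. ennreal (exp (- l * (x \<bullet> b - m \<bullet> b)\<^sup>2 / 2))) \<partial>lborel)"
  proof (rule nn_integral_mono)
    fix x :: "real^'k"
    have "(\<Sum>b\<in>Basis. (x \<bullet> b - m \<bullet> b)\<^sup>2) = (norm (x - m))\<^sup>2"
      unfolding power2_norm_eq_inner euclidean_inner[of "x - m" "x - m"]
      by (simp add: inner_diff_left power2_eq_square)
    then have "(\<Prod>b\<in>Basis. ennreal (exp (- l * (x \<bullet> b - m \<bullet> b)\<^sup>2 / 2))) = ennreal (exp (- l * (norm (x - m))\<^sup>2 / 2))"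
      by (simp add: prod_ennreal exp_sum[symmetric] sum_negf sum_divide_distrib[symmetric] sum_distrib_left[symmetric])
    then show "ennreal (exp (- ((x - m) \<bullet> (P *v (x - m))) / 2)) \<le> (\<Prod>b\<in>Basis. ennreal (exp (- l * (x \<bullet> b - m \<bullet> b)\<^sup>2 / 2)))"
      using l(2)[of "x - m"] by (simp add: ennreal_leI)
  qed
  also have "\<dots> = (\<Prod>b\<in>Basis. (\<integral>\<^sup>+t. ennreal (exp (- l * (t - m \<bullet> b)\<^sup>2 / 2)) \<partial>lborel))"
    by (rule nn_integral_lborel_prod) auto
  also have "\<dots> < \<infinity>"
    unfolding fin by (simp add: ennreal_power)
  finally show ?thesis .
qed

lemma integrable_euclideanI:
  fixes f :: "'a \<Rightarrow> 'b::euclidean_space"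
  assumes "\<And>b. b \<in> Basis \<Longrightarrow> integrable M (\<lambda>x. f x \<bullet> b)"
  shows "integrable M f"
proof -
  have "integrable M (\<lambda>x. \<Sum>b\<in>Basis. (f x \<bullet> b) *\<^sub>R b)"
    using assms by (intro Bochner_Integration.integrable_sum integrable_scaleR_left)
  then show ?thesis
    by (simp add: euclidean_representation)
qed

text \<open>Under \<open>\<mu>\<close> the identity map has the given density, so the marginal
  moments apply: first moments in the basis directions give the mean, second moments give the matrix
  entries.\<close>

lemma gaussian_covariance_matrix:
  fixes P :: "real^'k^'k"
  assumes \<mu>: "\<mu> = density lborel (\<lambda>x. ennreal (k * exp (- ((x - m) \<bullet> (P *v (x - m))) / 2)))"
    and "prob_space \<mu>" and P: "pos_def P"
  shows "covariance_matrix \<mu> = matrix_inv P"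
proof -
  interpret prob_space \<mu> by fact
  have meas: "(\<lambda>x. ennreal (k * exp (- ((x - m) \<bullet> (P *v (x - m))) / 2))) \<in> borel_measurable borel"
    by (intro measurable_compose[OF _ measurable_ennreal] borel_measurable_continuous_onI
        continuous_intros continuous_on_matrix_vector_mult) auto
  have D: "distributed \<mu> lborel (\<lambda>x. x) (\<lambda>x. ennreal (k * exp (- ((x - m) \<bullet> (P *v (x - m))) / 2)))"
    using meas by (simp add: distributed_def \<mu> distr_id2)
  note mom = gaussian_marginal_moments[OF \<open>prob_space \<mu>\<close> P D]
  have diff: "integrable \<mu> (\<lambda>x. x - m)"
    by (rule integrable_euclideanI) (rule mom)
  have diff0: "(\<integral>x. x - m \<partial>\<mu>) = 0"
    using diff by (intro euclidean_eqI[where 'a="real^'k"])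
      (simp add: integral_inner_left[symmetric] mom del: integral_inner_left)
  \<comment> \<open>The Bochner integral of a non-integrable function is zero by convention, so
    integrability has to precede the computation of the mean.\<close>
  have "integrable \<mu> (\<lambda>x. (x - m) + m)"
    using diff by (intro Bochner_Integration.integrable_add) auto
  then have "integrable \<mu> (\<lambda>x. x)"
    by simp
  then have mean: "(\<integral>x. x \<partial>\<mu>) = m"
    using diff0 by (simp add: prob_space)
  let ?O = "\<lambda>x. outer (x - m) (x - m)"
  \<comment> \<open>Polarization: the available moments concern squares of inner products, and a
    product of two coordinates is a difference of two such squares.\<close>
  have polar: "(x - m) $ i * (x - m) $ j
      = (((x - m) \<bullet> (axis i 1 + axis j 1))\<^sup>2 - ((x - m) \<bullet> (axis i 1 - axis j 1))\<^sup>2) / 4" for x i j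
    by (simp add: inner_add_right inner_diff_right inner_axis power2_eq_square algebra_simps)
  have int2: "integrable \<mu> (\<lambda>x. ?O x $ i $ j)" for i j
    unfolding outer_def by (simp only: vec_lambda_beta polar) (intro integrable_divide Bochner_Integration.integrable_diff mom)
  have E2: "(\<integral>x. ?O x $ i $ j \<partial>\<mu>) = matrix_inv P $ i $ j" for i j
  proof -
    define J where "J = matrix_inv P"
    have sym: "a \<bullet> (J *v b) = b \<bullet> (J *v a)" for a b
      using pos_def_symmetric[OF pos_def_matrix_inv[OF P], of a b] by (simp add: J_def inner_commute)
    have "(\<integral>x. ?O x $ i $ j \<partial>\<mu>) = ((axis i 1 + axis j 1) \<bullet> (J *v (axis i 1 + axis j 1))
        - (axis i 1 - axis j 1) \<bullet> (J *v (axis i 1 - axis j 1))) / 4"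
      unfolding outer_def by (simp only: vec_lambda_beta polar) (simp add: mom J_def)
    also have "\<dots> = axis i 1 \<bullet> (J *v axis j 1)"
      using sym[of "axis i 1" "axis j 1"]
      by (simp add: matrix_vector_right_distrib matrix_vector_mult_diff_distrib inner_add_left inner_add_right
          inner_diff_left inner_diff_right)
    also have "\<dots> = J $ i $ j"
      by (simp add: inner_axis' matrix_vector_mult_basis column_def)
    finally show ?thesis
      by (simp add: J_def)
  qed
  \<comment> \<open>Entries are inner products with basis matrices, which allows the integral to be
    taken entrywise.\<close>
  have comp: "x \<bullet> axis i (axis j 1) = x $ i $ j" for x :: "real^'k^'k" and i j
    by (simp add: inner_axis)
  have intO: "integrable \<mu> ?O"
    by (rule integrable_euclideanI) (auto simp: Basis_vec_def comp int2)
  have "(\<integral>x. ?O x \<partial>\<mu>) $ i $ j = (\<integral>x. ?O x $ i $ j \<partial>\<mu>)" for i j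
    unfolding comp[symmetric] using intO by (subst integral_inner_left) auto
  then have "(\<integral>x. ?O x \<partial>\<mu>) = matrix_inv P"
    by (simp add: vec_eq_iff E2)
  then show ?thesis
    by (simp add: covariance_matrix_def mean)
qed

text \<open>The offset \<open>a\<close> only rescales the density and is absorbed by the
  normalization, leaving a Gaussian with inverse covariance \<open>P\<close>.\<close>

lemma posterior_quadratic:
  fixes P :: "real^'k^'k"
  assumes P: "pos_def P" and \<Phi>: "\<And>\<theta>. \<Phi> \<theta> = a + (\<theta> - m) \<bullet> (P *v (\<theta> - m)) / 2"
  shows "prob_space (posterior (\<lambda>_. 1) \<Phi>)" "covariance_matrix (posterior (\<lambda>_. 1) \<Phi>) = matrix_inv P"
proof -
  let ?g = "\<lambda>x. exp (- ((x - m) \<bullet> (P *v (x - m))) / 2)"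
  have exp_eq: "exp (- \<Phi> \<theta>) = exp (- a) * ?g \<theta>" for \<theta>
    by (simp add: \<Phi> exp_add[symmetric])
  have meas: "?g \<in> borel_measurable borel"
    by (intro borel_measurable_continuous_onI continuous_intros continuous_on_matrix_vector_mult) auto
  have g: "integrable lborel ?g"
    using nn_integral_gaussian_finite[OF P, of m] meas by (intro integrableI_nonneg) auto
  then have int: "integrable lborel (\<lambda>\<theta>. exp (- \<Phi> \<theta>))"
    by (simp add: exp_eq)
  define Z where "Z = (\<integral>\<theta>. exp (- \<Phi> \<theta>) \<partial>lborel)"
  \<comment> \<open>\<open>posterior\<close> divides by \<open>Z\<close>, and division by zero would
    give the null measure; an everywhere positive integrable function has nonzero integral.\<close>
  have "Z \<noteq> 0"
  proof
    assume "Z = 0"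
    then have "AE \<theta> in lborel. exp (- \<Phi> \<theta>) = 0"
      using int by (simp add: Z_def integral_nonneg_eq_0_iff_AE)
    then show False
      by (simp add: eventually_False ae_filter_eq_bot_iff)
  qed
  moreover have "0 \<le> Z"
    by (simp add: Z_def)
  ultimately have Z: "0 < Z" by simp
  have \<mu>: "posterior (\<lambda>_. 1) \<Phi> = density lborel (\<lambda>\<theta>. ennreal (exp (- a) / Z * ?g \<theta>))"
    unfolding posterior_def mult_1_right Z_def[symmetric] by (simp add: exp_eq)
  show prob: "prob_space (posterior (\<lambda>_. 1) \<Phi>)"
  proof
    have "emeasure (posterior (\<lambda>_. 1) \<Phi>) (space (posterior (\<lambda>_. 1) \<Phi>)) = (\<integral>\<^sup>+\<theta>. ennreal (exp (- \<Phi> \<theta>) / Z) \<partial>lborel)"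
      using meas by (simp add: \<mu> emeasure_density exp_eq)
    also have "\<dots> = ennreal (\<integral>\<theta>. exp (- \<Phi> \<theta>) / Z \<partial>lborel)"
      using int Z by (intro nn_integral_eq_integral) auto
    also have "\<dots> = 1"
      using Z by (simp add: Z_def[symmetric])
    finally show "emeasure (posterior (\<lambda>_. 1) \<Phi>) (space (posterior (\<lambda>_. 1) \<Phi>)) = 1" .
  qed
  show "covariance_matrix (posterior (\<lambda>_. 1) \<Phi>) = matrix_inv P"
    by (rule gaussian_covariance_matrix[OF \<mu> prob P])
qed

section \<open>The three-sigma interval\<close>

text \<open>The value 3/2000 is half of the admissible 0.3 percent. It amounts to
  \<open>sqrt (2 * pi) * exp (9/2)\<close> being at least 2000/9 = 222.2..., and 2.5 * 89 = 222.5
  suffices; the factor 89 is checked after squaring, where the exponent 9 is an integer.\<close>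

lemma std_normal_density_3_bound: "std_normal_density 3 / 3 \<le> 3 / 2000"
proof -
  have "(2718 / 1000 :: real) \<le> exp 1"
    using e_approx_32 by (simp add: abs_if split: if_splits)
  then have "(2718 / 1000 :: real) ^ 9 \<le> exp 1 ^ 9"
    by (intro power_mono) auto
  moreover have "(exp (9/2) :: real)\<^sup>2 = exp 1 ^ 9"
    by (simp add: exp_of_nat_mult[symmetric] power2_eq_square exp_add[symmetric])
  moreover have "(89::real)\<^sup>2 \<le> (2718 / 1000) ^ 9"
    by (simp add: power_divide divide_simps)
  ultimately have "(89::real)\<^sup>2 \<le> (exp (9/2))\<^sup>2"
    by linarith
  then have e: "89 \<le> exp (9/2::real)"
    by (rule power2_le_imp_le) simp
  have p: "25 / 10 \<le> sqrt (2 * pi)"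
    using pi_approx by (intro real_le_rsqrt) (simp add: power2_eq_square)
  have "222 + 1 / 2 \<le> sqrt (2 * pi) * exp (9/2)"
    using mult_mono[OF p e] by simp
  then show ?thesis
    by (simp add: std_normal_density_def exp_minus field_simps)
qed

text \<open>Mills' ratio: on \<open>{3..}\<close> the density is at most \<open>x / 3\<close> times itself, which integrates explicitly.\<close>

lemma (in prob_space) std_normal_upper_tail:
  assumes X: "distributed M lborel X std_normal_density"
  shows "prob {\<omega> \<in> space M. 3 < X \<omega>} \<le> 3 / 2000"
proof -
  have deriv: "((\<lambda>x. - (std_normal_density x / 3)) has_field_derivative (x / 3 * std_normal_density x)) (at x)" for x
    unfolding std_normal_density_def by (auto intro!: derivative_eq_intros simp: field_simps)
  have "((\<lambda>x::real. exp (- x\<^sup>2 / 2)) \<longlongrightarrow> 0) at_top"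
    by real_asymp
  then have "((\<lambda>x. - (std_normal_density x / 3)) \<longlongrightarrow> - (1 / sqrt (2 * pi) * 0 / 3)) at_top"
    unfolding std_normal_density_def
    by (intro tendsto_minus tendsto_divide tendsto_mult_left tendsto_const) auto
  then have lim: "((\<lambda>x. - (std_normal_density x / 3)) \<longlongrightarrow> 0) at_top"
    by simp
  have "emeasure M {\<omega> \<in> space M. 3 < X \<omega>} = emeasure M (X -` {3<..} \<inter> space M)"
    by (intro arg_cong[where f="emeasure M"]) auto
  also have "\<dots> = (\<integral>\<^sup>+x. ennreal (std_normal_density x) * indicator {3<..} x \<partial>lborel)"
    by (rule distributed_emeasure[OF X]) simp
  also have "\<dots> \<le> (\<integral>\<^sup>+x. ennreal (x / 3 * std_normal_density x) * indicator {3..} x \<partial>lborel)"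
  proof (rule nn_integral_mono)
    fix x
    have "std_normal_density x \<le> x / 3 * std_normal_density x" if "3 < x"
      using mult_right_mono[of 1 "x / 3" "std_normal_density x"] that by simp
    then show "ennreal (std_normal_density x) * indicator {3<..} x
        \<le> ennreal (x / 3 * std_normal_density x) * indicator {3..} x"
      by (auto split: split_indicator intro!: ennreal_leI)
  qed
  also have "\<dots> = ennreal (0 - - (std_normal_density 3 / 3))"
    by (intro nn_integral_FTC_atLeast lim deriv) auto
  also have "\<dots> \<le> ennreal (3 / 2000)"
    using std_normal_density_3_bound by (intro ennreal_leI) simp
  finally show ?thesis
    by (simp add: emeasure_eq_measure)
qed

text \<open>Union bound over the two tails of the standardized variable; its negative is again
  standard normal, so each tail costs at most 3/2000.\<close>

lemma (in prob_space) normal_three_sigma: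
  assumes \<sigma>: "0 < \<sigma>" and X: "distributed M lborel X (normal_density 0 \<sigma>)"
  shows "99.7 / 100 \<le> prob {\<omega> \<in> space M. \<bar>X \<omega>\<bar> \<le> 3 * \<sigma>}"
proof -
  have [measurable]: "X \<in> borel_measurable M"
    using distributed_measurable[OF X] by simp
  have Y: "distributed M lborel (\<lambda>\<omega>. X \<omega> / \<sigma>) std_normal_density"
    using X normal_standard_normal_convert[OF \<sigma>, of X 0] by simp
  have Z: "distributed M lborel (\<lambda>\<omega>. - (X \<omega> / \<sigma>)) std_normal_density"
    using normal_density_affine[OF Y, of "-1" 0] by simp
  have "prob (space M - {\<omega> \<in> space M. \<bar>X \<omega>\<bar> \<le> 3 * \<sigma>})
      = prob ({\<omega> \<in> space M. 3 < X \<omega> / \<sigma>} \<union> {\<omega> \<in> space M. 3 < - (X \<omega> / \<sigma>)})"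
    using \<sigma> by (intro arg_cong[where f=prob]) (auto simp: field_simps abs_if split: if_splits)
  also have "\<dots> \<le> prob {\<omega> \<in> space M. 3 < X \<omega> / \<sigma>} + prob {\<omega> \<in> space M. 3 < - (X \<omega> / \<sigma>)}"
    by (rule measure_Un_le) measurable
  also have "\<dots> \<le> 3 / 2000 + 3 / 2000"
    by (intro add_mono std_normal_upper_tail Y Z)
  finally show ?thesis
    by (subst (asm) prob_compl) auto
qed

context linear_inverse_problem
begin

text \<open>Component \<open>i\<close> of the error is, up to sign, the noise paired with a fixed
  vector \<open>u\<close>. It is therefore centered normal with variance
  \<open>u \<bullet> (\<Sigma> *v u)\<close>, which collapses to the diagonal entry of
  \<open>matrix_inv precision\<close>.\<close>

lemma estimate_three_sigma:
  assumes "prob_space M"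
    and D: "distributed M lborel (\<lambda>\<omega>. y \<omega> - G *v \<theta>) (\<lambda>x. ennreal (gaussian_density 0 \<Sigma> x))"
  shows "99.7 / 100 \<le> measure M {\<omega> \<in> space M. \<bar>\<theta> $ i - estimate (y \<omega>) $ i\<bar> \<le> 3 * sqrt (matrix_inv precision $ i $ i)}"
proof -
  interpret prob_space M by fact
  define w where "w = G *v (matrix_inv precision *v axis i 1)"
  define u where "u = matrix_inv \<Sigma> *v w"
  \<comment> \<open>\<open>gaussian_marginal\<close> is stated for the inverse covariance, here
    \<open>matrix_inv \<Sigma>\<close>, and inverts it once more in the variance.\<close>
  have inv_inv: "matrix_inv (matrix_inv \<Sigma>) = \<Sigma>"
    by (rule matrix_inv_unique) (rule matrix_inv_left[OF pos_def_invertible[OF \<Sigma>]])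
  note J = pos_def_matrix_inv[OF pos_def_precision]
  \<comment> \<open>Symmetry moves all matrices onto \<open>axis i 1\<close>; the trailing
    \<open>- 0\<close> is the mean of the noise, in the shape expected by
    \<open>gaussian_marginal\<close>.\<close>
  have err: "\<theta> $ i - estimate (y \<omega>) $ i = - ((y \<omega> - G *v \<theta> - 0) \<bullet> u)" for \<omega>
  proof -
    define \<eta> where "\<eta> = y \<omega> - G *v \<theta>"
    have "\<theta> $ i - estimate (y \<omega>) $ i = axis i 1 \<bullet> (\<theta> - estimate (y \<omega>))"
      by (simp add: inner_axis')
    also have "\<dots> = - (axis i 1 \<bullet> (matrix_inv precision *v (transpose G *v (matrix_inv \<Sigma> *v \<eta>))))"
      by (simp add: estimate_error \<eta>_def)
    also have "\<dots> = - (w \<bullet> (matrix_inv \<Sigma> *v \<eta>))"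
      by (simp add: pos_def_symmetric[OF J] inner_transpose_mult w_def)
    also have "\<dots> = - (\<eta> \<bullet> u)"
      using pos_def_symmetric[OF pos_def_matrix_inv[OF \<Sigma>], of w \<eta>] by (simp add: u_def inner_commute)
    finally show ?thesis
      by (simp add: \<eta>_def)
  qed
  have var: "u \<bullet> (matrix_inv (matrix_inv \<Sigma>) *v u) = matrix_inv precision $ i $ i"
  proof -
    have "u \<bullet> (matrix_inv (matrix_inv \<Sigma>) *v u) = w \<bullet> (matrix_inv \<Sigma> *v w)"
      using \<Sigma> by (simp add: inv_inv u_def inner_commute)
    also have "\<dots> = (matrix_inv precision *v axis i 1) \<bullet> (precision *v (matrix_inv precision *v axis i 1))"
      by (simp add: w_def precision_mult inner_transpose_mult)
    also have "\<dots> = matrix_inv precision $ i $ i"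
      unfolding pos_def_matrix_inv_cancel(1)[OF pos_def_precision]
      by (simp add: inner_axis matrix_vector_mult_basis column_def)
    finally show ?thesis .
  qed
  have "0 < axis i 1 \<bullet> (matrix_inv precision *v axis i 1)"
    by (rule pos_def_pos[OF J]) (simp add: axis_eq_0_iff)
  then have pos: "0 < matrix_inv precision $ i $ i"
    by (simp add: inner_axis' matrix_vector_mult_basis column_def)
  then have "u \<noteq> 0"
    using var by auto
  have "distributed M lborel (\<lambda>\<omega>. (y \<omega> - G *v \<theta> - 0) \<bullet> u) (normal_density 0 (sqrt (matrix_inv precision $ i $ i)))"
    unfolding var[symmetric]
    by (rule gaussian_marginal[OF assms(1) pos_def_matrix_inv[OF \<Sigma>] \<open>u \<noteq> 0\<close>,
          where k="1 / sqrt ((2 * pi) ^ CARD('m) * det \<Sigma>)"])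
      (use D in \<open>simp add: gaussian_density_def\<close>)
  from normal_three_sigma[OF _ this] pos show ?thesis
    by (simp add: err)
qed

end

theorem theorem1:
  fixes \<kappa> :: real
    and G :: "real^('n::{finite,linorder})^'m"
    and \<Sigma>\<^sub>\<eta> :: "real^'m^'m"
    and m\<^sub>0 :: "real^('n::_)"
    and C\<^sub>0 :: "real^('n::_)^('n::_)"
  assumes "0 < real CARD('n) + \<kappa>"
    and "pos_def \<Sigma>\<^sub>\<eta>"
    and "rank G = CARD('n)"
    and "pos_def C\<^sub>0"
  shows "\<exists>(m_inf :: real^'m \<Rightarrow> real^('n::_)) (C_inf :: real^('n::_)^('n::_)).
    (\<forall>y.
      let \<Phi> = misfit (\<lambda>\<theta>. G *v \<theta>) \<Sigma>\<^sub>\<eta> y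
      in exp_converges (\<lambda>n. fst (uki \<kappa> (\<lambda>\<theta>. G *v \<theta>) \<Sigma>\<^sub>\<eta> y m\<^sub>0 C\<^sub>0 n)) (m_inf y) \<and>
         exp_converges (\<lambda>n. snd (uki \<kappa> (\<lambda>\<theta>. G *v \<theta>) \<Sigma>\<^sub>\<eta> y m\<^sub>0 C\<^sub>0 n)) C_inf \<and>
         is_arg_min \<Phi> (\<lambda>_. True) (m_inf y) \<and>
         C_inf = matrix_inv (transpose G ** matrix_inv \<Sigma>\<^sub>\<eta> ** G) \<and>
         prob_space (posterior (\<lambda>_. 1) \<Phi>) \<and>
         C_inf = covariance_matrix (posterior (\<lambda>_. 1) \<Phi>)) \<and>
    (\<forall>(M :: 'a measure) (y :: 'a \<Rightarrow> real^'m) (\<theta>_ref :: real^('n::_)).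
      prob_space M \<and>
      distributed M lborel (\<lambda>\<omega>. y \<omega> - G *v \<theta>_ref) (\<lambda>x. ennreal (gaussian_density 0 \<Sigma>\<^sub>\<eta> x)) \<longrightarrow>
      (\<forall>i. measure M {\<omega> \<in> space M. \<bar>\<theta>_ref $ i - m_inf (y \<omega>) $ i\<bar> \<le> 3 * sqrt (C_inf $ i $ i)} \<ge> 99.7 / 100))"
proof -
  interpret linear_inverse_problem G \<Sigma>\<^sub>\<eta>
    using assms by unfold_locales
  have "\<forall>(M :: 'a measure) (y :: 'a \<Rightarrow> real^'m) (\<theta>_ref :: real^('n::_)).
      prob_space M \<and>
      distributed M lborel (\<lambda>\<omega>. y \<omega> - G *v \<theta>_ref) (\<lambda>x. ennreal (gaussian_density 0 \<Sigma>\<^sub>\<eta> x)) \<longrightarrow>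
      (\<forall>i. measure M {\<omega> \<in> space M. \<bar>\<theta>_ref $ i - estimate (y \<omega>) $ i\<bar>
        \<le> 3 * sqrt (matrix_inv precision $ i $ i)} \<ge> 99.7 / 100)"
    using estimate_three_sigma by blast
  \<comment> \<open>The limiting mean is supplied as the function \<open>estimate\<close>, so that
    one witness serves every fixed observation as well as the random one.\<close>
  then show ?thesis
    unfolding Let_def
    using uki_mean_converges[OF assms(1,4)] uki_covariance_converges[OF assms(1,4)]
      estimate_is_minimizer posterior_quadratic[OF pos_def_precision misfit_eq]
    by (intro exI[of _ estimate] exI[of _ "matrix_inv precision"] conjI)
      (simp_all flip: precision_def)
qed

end
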